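(* Let $q\ge 4$ be fixed, let $G$ be the path on vertices $1,\dots,n$, and let $\Omega$ be the set of proper $q$-colorings of $G$. Let $\mathcal{M}_{\mathrm{Gl}}$ be the Glauber dynamics on $\Omega$. For any fixed $\varepsilon<1$ and all sufficiently large $n$, $$\mathrm{Mix}(\mathcal{M}_{\mathrm{Gl}},\varepsilon)\ \ge\ \frac{q\,n\left(\tfrac13\log_{q-1}n-2\right)}{2e(q-1)},$$ where $e$ is the base of natural logarithms.
   Context: The $n$-vertex path has vertices $1,\dots,n$ and edges $\{i,i+1\}$. A $q$-coloring is a vector $\sigma=(\sigma_1,\dots,\sigma_n)\in\{0,\dots,q-1\}^n$; it is proper if adjacent vertices receive different colors. The procedure Metropolis($v$): choose a color $c\in\{0,\dots,q-1\}$ uniformly at random and propose recoloring $v$ with $c$; the proposal is accepted if and only if $c$ is not used at any neighbor of $v$ (otherwise the coloring is unchanged). One step of the Markov chain $\mathcal{M}_{\mathrm{Gl}}$ (Glauber dynamics): choose a vertex $v$ uniformly at random and do Metropolis($v$). Its stationary distribution is uniform on $\Omega$. For a Markov chain $\mathcal{M}$ with transition matrix $P$ and stationary distribution $\pi$, $\mathrm{Mix}_x(\mathcal{M},\varepsilon)=\min\{t>0:\mathrm{d_{TV}}(P^t(x,\cdot),\pi(\cdot))\le\varepsilon\}$ and $\mathrm{Mix}(\mathcal{M},\varepsilon)=\max_x\mathrm{Mix}_x(\mathcal{M},\varepsilon)$, where $\mathrm{d_{TV}}(\theta_1,\theta_2)=\frac12\sum_i|\theta_1(i)-\theta_2(i)|$.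 *)

theory Defs
  imports "HOL-Probability.Probability"
begin

section \<open>Mixing times\<close>

text \<open>
  A Markov chain is given by its transition kernel \<open>K\<close>, so \<open>pmf (K x) y\<close> is the entry
  \<open>P(x,y)\<close> of its transition matrix and \<open>pmf (kernel_pow K t x) y\<close> is \<open>P\<^sup>t(x,y)\<close>.
\<close>

primrec kernel_pow :: "('a \<Rightarrow> 'a pmf) \<Rightarrow> nat \<Rightarrow> 'a \<Rightarrow> 'a pmf" where
  "kernel_pow K 0 x = return_pmf x"
| "kernel_pow K (Suc t) x = bind_pmf (kernel_pow K t x) K"

definition tv_dist :: "'a set \<Rightarrow> 'a pmf \<Rightarrow> 'a pmf \<Rightarrow> real" where
  "tv_dist S \<theta>1 \<theta>2 = 1 / 2 * (\<Sum>i\<in>S. \<bar>pmf \<theta>1 i - pmf \<theta>2 i\<bar>)"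

text \<open>
  Mixing times take values in \<^typ>\<open>enat\<close>: the infimum is the minimum if some \<open>t > 0\<close>
  qualifies, and \<open>\<infinity>\<close> otherwise (for instance whenever \<open>\<epsilon> < 0\<close>).
\<close>

definition mix_from :: "'a set \<Rightarrow> ('a \<Rightarrow> 'a pmf) \<Rightarrow> 'a pmf \<Rightarrow> real \<Rightarrow> 'a \<Rightarrow> enat" where
  "mix_from S K \<pi> \<epsilon> x = Inf (enat ` {t. t > 0 \<and> tv_dist S (kernel_pow K t x) \<pi> \<le> \<epsilon>})"

text \<open>For a finite nonempty state space \<open>S\<close>, the supremum is a maximum.\<close>

definition mix :: "'a set \<Rightarrow> ('a \<Rightarrow> 'a pmf) \<Rightarrow> 'a pmf \<Rightarrow> real \<Rightarrow> enat" where
  "mix S K \<pi> \<epsilon> = (SUP x\<in>S. mix_from S K \<pi> \<epsilon> x)"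


section \<open>Glauber dynamics on colorings\<close>

text \<open>
  Colorings are extensional functions, so that two colorings are equal iff they agree on \<open>V\<close>.
\<close>

definition colorings :: "'v set \<Rightarrow> nat \<Rightarrow> ('v \<Rightarrow> nat) set" where
  "colorings V q = V \<rightarrow>\<^sub>E {0..<q}"

definition proper_colorings :: "'v set \<Rightarrow> 'v set set \<Rightarrow> nat \<Rightarrow> ('v \<Rightarrow> nat) set" where
  "proper_colorings V E q =
     {\<sigma> \<in> colorings V q. \<forall>u v. {u, v} \<in> E \<longrightarrow> \<sigma> u \<noteq> \<sigma> v}"

definition metropolis :: "'v set set \<Rightarrow> nat \<Rightarrow> 'v \<Rightarrow> ('v \<Rightarrow> nat) \<Rightarrow> ('v \<Rightarrow> nat) pmf" where
  "metropolis E q v \<sigma> =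
     bind_pmf (pmf_of_set {0..<q})
       (\<lambda>c. return_pmf (if \<forall>u. {u, v} \<in> E \<longrightarrow> \<sigma> u \<noteq> c then \<sigma>(v := c) else \<sigma>))"

definition glauber :: "'v set \<Rightarrow> 'v set set \<Rightarrow> nat \<Rightarrow> ('v \<Rightarrow> nat) \<Rightarrow> ('v \<Rightarrow> nat) pmf" where
  "glauber V E q \<sigma> = bind_pmf (pmf_of_set V) (\<lambda>v. metropolis E q v \<sigma>)"

definition path_vertices :: "nat \<Rightarrow> nat set" where
  "path_vertices n = {1..n}"

definition path_edges :: "nat \<Rightarrow> nat set set" where
  "path_edges n = {{i, i + 1} | i. 1 \<le> i \<and> i + 1 \<le> n}"

definition mix_glauber_path :: "nat \<Rightarrow> nat \<Rightarrow> real \<Rightarrow> enat" where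
  "mix_glauber_path q n \<epsilon> =
     (let \<Omega> = proper_colorings (path_vertices n) (path_edges n) q
      in mix \<Omega> (glauber (path_vertices n) (path_edges n) q) (pmf_of_set \<Omega>) \<epsilon>)"


section \<open>The chain lives on the proper colorings and has uniform stationary distribution\<close>

lemma finite_proper_colorings: "finite V \<Longrightarrow> finite (proper_colorings V E q)"
  unfolding proper_colorings_def colorings_def by (simp add: finite_PiE)

lemma proper_colorings_path_nonempty:
  assumes "q \<ge> 2"
  shows "proper_colorings (path_vertices n) (path_edges n) q \<noteq> {}"
proof -
  have "(\<lambda>i\<in>path_vertices n. i mod 2)
          \<in> proper_colorings (path_vertices n) (path_edges n) q"
    using assms
    by (auto simp: proper_colorings_def colorings_def path_vertices_def path_edges_def
          doubleton_eq_iff mod2_eq_if)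
  then show ?thesis by blast
qed

lemma set_metropolis_subset:
  assumes "q > 0" "v \<in> V" "\<sigma> \<in> proper_colorings V E q"
  shows "set_pmf (metropolis E q v \<sigma>) \<subseteq> proper_colorings V E q"
proof -
  have nl: "{v, v} \<notin> E"
    using assms(3) unfolding proper_colorings_def by blast
  have upd: "\<sigma>(v := c) \<in> proper_colorings V E q"
    if "c < q" and acc: "\<forall>u. {u, v} \<in> E \<longrightarrow> \<sigma> u \<noteq> c" for c
  proof -
    have "\<sigma>(v := c) \<in> colorings V q"
      using assms that by (auto simp: proper_colorings_def colorings_def PiE_iff extensional_def)
    moreover have "(\<sigma>(v := c)) a \<noteq> (\<sigma>(v := c)) b" if "{a, b} \<in> E" for a b
    proof (cases "a = v")
      case True
      with that nl have "b \<noteq> v" "{b, v} \<in> E" by (auto simp: insert_commute)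
      with acc True show ?thesis by auto
    next
      case False
      with that acc assms(3) show ?thesis by (auto simp: proper_colorings_def)
    qed
    ultimately show ?thesis by (auto simp: proper_colorings_def)
  qed
  show ?thesis
    using assms upd by (auto simp: metropolis_def set_pmf_of_set)
qed

lemma pmf_metropolis:
  assumes "q > 0"
  shows "pmf (metropolis E q v \<sigma>) \<tau> =
     real (card {c\<in>{0..<q}. (if \<forall>u. {u, v} \<in> E \<longrightarrow> \<sigma> u \<noteq> c then \<sigma>(v := c) else \<sigma>) = \<tau>}) / q"
proof -
  have "metropolis E q v \<sigma> = map_pmf
     (\<lambda>c. if \<forall>u. {u, v} \<in> E \<longrightarrow> \<sigma> u \<noteq> c then \<sigma>(v := c) else \<sigma>) (pmf_of_set {0..<q})"
    by (simp add: metropolis_def map_pmf_def)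
  then show ?thesis
    using assms
    by (simp add: pmf_map measure_pmf_of_set vimage_def Int_def)
qed

lemma metropolis_symmetric:
  assumes "q > 0" "v \<in> V" "\<sigma> \<in> proper_colorings V E q" "\<tau> \<in> proper_colorings V E q"
  shows "pmf (metropolis E q v \<sigma>) \<tau> = pmf (metropolis E q v \<tau>) \<sigma>"
proof (cases "\<sigma> = \<tau>")
  case False
  have cnt: "{c\<in>{0..<q}. (if \<forall>u. {u, v} \<in> E \<longrightarrow> a u \<noteq> c then a(v := c) else a) = b}
        = (if \<forall>w. w \<noteq> v \<longrightarrow> a w = b w then {b v} else {})"
    if "a \<in> proper_colorings V E q" "b \<in> proper_colorings V E q" "a \<noteq> b" for a b
  proof -
    let ?f = "\<lambda>c. if \<forall>u. {u, v} \<in> E \<longrightarrow> a u \<noteq> c then a(v := c) else a"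
    have "b v < q"
      using that assms(2) by (auto simp: proper_colorings_def colorings_def PiE_iff)
    have moved: "c = b v \<and> (\<forall>w. w \<noteq> v \<longrightarrow> a w = b w)" if "?f c = b" for c
    proof -
      have "a(v := c) = b"
        using that \<open>a \<noteq> b\<close> by (meson)
      then show ?thesis by auto
    qed
    have move: "?f (b v) = b" if agree: "\<forall>w. w \<noteq> v \<longrightarrow> a w = b w"
    proof -
      have "a u \<noteq> b v" if "{u, v} \<in> E" for u
      proof -
        have "b u \<noteq> b v"
          using that \<open>b \<in> _\<close> unfolding proper_colorings_def by blast
        then show ?thesis using agree by metis
      qed
      moreover have "a(v := b v) = b"
        using agree by auto
      ultimately show ?thesis by simp
    qed
    show ?thesis
    proof (cases "\<forall>w. w \<noteq> v \<longrightarrow> a w = b w")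
      case True
      have "{c\<in>{0..<q}. ?f c = b} = {b v}"
      proof
        show "{c\<in>{0..<q}. ?f c = b} \<subseteq> {b v}"
          using moved by blast
        show "{b v} \<subseteq> {c\<in>{0..<q}. ?f c = b}"
          using move[OF True] \<open>b v < q\<close> by simp
      qed
      then show ?thesis unfolding if_P[OF True] .
    next
      case False
      have "{c\<in>{0..<q}. ?f c = b} = {}"
        using moved False by blast
      then show ?thesis unfolding if_not_P[OF False] .
    qed
  qed
  show ?thesis
    unfolding pmf_metropolis[OF assms(1)] cnt[OF assms(3,4) False]
      cnt[OF assms(4,3) False[symmetric]]
    by (auto simp: eq_commute[of "\<tau> _" "\<sigma> _"])
qed simp

lemma metropolis_stationary:
  assumes "q > 0" "finite V" "v \<in> V" "proper_colorings V E q \<noteq> {}"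
  shows "bind_pmf (pmf_of_set (proper_colorings V E q)) (metropolis E q v)
           = pmf_of_set (proper_colorings V E q)"
proof (rule pmf_eqI)
  fix \<tau>
  let ?S = "proper_colorings V E q"
  note fin = finite_proper_colorings[OF assms(2), of E q]
  have "(\<Sum>\<sigma>\<in>?S. pmf (metropolis E q v \<sigma>) \<tau>) = indicator ?S \<tau>"
  proof (cases "\<tau> \<in> ?S")
    case True
    have "(\<Sum>\<sigma>\<in>?S. pmf (metropolis E q v \<sigma>) \<tau>) = (\<Sum>\<sigma>\<in>?S. pmf (metropolis E q v \<tau>) \<sigma>)"
      using metropolis_symmetric[OF assms(1,3) _ True] by simp
    also have "\<dots> = 1"
      by (rule sum_pmf_eq_1[OF fin set_metropolis_subset[OF assms(1,3) True]])
    finally show ?thesis using True by simp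
  next
    case False
    then have "pmf (metropolis E q v \<sigma>) \<tau> = 0" if "\<sigma> \<in> ?S" for \<sigma>
      using set_metropolis_subset[OF assms(1,3) that] by (auto simp: pmf_eq_0_set_pmf)
    with False show ?thesis by simp
  qed
  then show "pmf (bind_pmf (pmf_of_set ?S) (metropolis E q v)) \<tau> = pmf (pmf_of_set ?S) \<tau>"
    using fin assms(4) by (simp add: pmf_bind integral_pmf_of_set)
qed

lemma set_glauber_subset:
  assumes "q > 0" "finite V" "V \<noteq> {}" "\<sigma> \<in> proper_colorings V E q"
  shows "set_pmf (glauber V E q \<sigma>) \<subseteq> proper_colorings V E q"
  using set_metropolis_subset[OF assms(1) _ assms(4)] assms(2,3)
  by (simp add: glauber_def set_pmf_of_set UN_least)

lemma glauber_stationary: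
  assumes "q > 0" "finite V" "V \<noteq> {}" "proper_colorings V E q \<noteq> {}"
  shows "bind_pmf (pmf_of_set (proper_colorings V E q)) (glauber V E q)
           = pmf_of_set (proper_colorings V E q)"
proof -
  let ?S = "proper_colorings V E q"
  have "bind_pmf (pmf_of_set ?S) (glauber V E q)
      = bind_pmf (pmf_of_set V) (\<lambda>v. bind_pmf (pmf_of_set ?S) (metropolis E q v))"
    unfolding glauber_def by (rule bind_commute_pmf)
  also have "\<dots> = bind_pmf (pmf_of_set V) (\<lambda>v. pmf_of_set ?S)"
    using assms by (intro bind_pmf_cong metropolis_stationary) (simp_all add: set_pmf_of_set)
  finally show ?thesis by simp
qed

end

theory Submission
  imports Defs "HOL-Real_Asymp.Real_Asymp"
begin

text \<open>
  The dynamics is started from the coloring that alternates between 0 and 1, and it is compared with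
  equilibrium by a statistic that measures correlations over a distance \<open>d\<close> of order \<open>log n\<close>. Let
  the charge of a color be 1 for color 2, \<open>- 1\<close> for color 3 and 0 otherwise; the statistic is the
  sum, over about \<open>n / (3 d)\<close> separated pairs of vertices at distance \<open>d\<close>, of the products of the
  charges at the two ends.

  In equilibrium the colors along the path form a Markov chain with eigenvalue \<open>- 1 / (q - 1)\<close> on
  functions with sum zero, so each product has mean \<open>(2 / q) (- 1 / (q - 1)) ^ d\<close>, and distant pairs
  are nearly independent (\<open>unif_total_stat_mean\<close>, \<open>unif_total_stat_variance\<close>).

  At time \<open>t\<close> the exchange of the colors 2 and 3 leaves the law of the chain invariant, so each charge
  has mean zero and the mean of a product is the covariance of the charges at its ends. This
  covariance has to be built up by the dynamics: some vertex must have influenced both ends.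
  How fast influence travels is governed by a linear operator on oscillation profiles
  (\<open>osc_bound_step\<close>, the analytic form of a coupling argument). Testing this operator with
  exponential profiles \<open>z\<close> to the power of the distance shows that the covariance is essentially at most
  \<open>exp (2 t z / (n q)) / z ^ d\<close> (\<open>two_site_covariance_le\<close>). For \<open>z = e (q - 1)\<close>, for
  times below the bound of the theorem and for \<open>d\<close> slightly larger than \<open>1 / 3\<close> of \<open>log n\<close> to
  the base \<open>q - 1\<close>, this is far below \<open>1 / (q - 1) ^ d\<close>. For \<open>q \<ge> 4\<close> the same operator does not
  increase Lipschitz constants, so the statistic has variance of order at most \<open>t\<close>
  (\<open>alternating_total_stat_variance\<close>).

  Thus the means differ by about \<open>(n / d) / (q - 1) ^ d\<close>. This exceeds the standard deviations, which
  are of order at most the square root of \<open>n log n\<close>, as long as \<open>d\<close> is less than half of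
  \<open>log n\<close> to the base \<open>q - 1\<close>. Chebyshev's inequality then shows that the total variation distance
  is close to 1.
\<close>

section \<open>Total variation distance and test statistics\<close>

text \<open>
  The differences of the two densities sum to zero over \<open>S\<close>, so the excess inside \<open>B\<close> equals the
  deficit outside \<open>B\<close>; each is at most half of the \<open>L\<^sup>1\<close> distance.
\<close>

lemma prob_diff_le_tv_dist:
  assumes "finite S" "set_pmf \<theta>1 \<subseteq> S" "set_pmf \<theta>2 \<subseteq> S"
  shows "measure_pmf.prob \<theta>2 B - measure_pmf.prob \<theta>1 B \<le> tv_dist S \<theta>1 \<theta>2"
proof -
  define D where "D i = pmf \<theta>2 i - pmf \<theta>1 i" for i
  have prob: "measure_pmf.prob p B = sum (pmf p) (S \<inter> B)" if "set_pmf p \<subseteq> S" for p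
  proof -
    have "measure_pmf.prob p B = measure_pmf.prob p (S \<inter> B)"
      by (rule measure_prob_cong_0) (use that in \<open>auto simp: set_pmf_iff\<close>)
    then show ?thesis using assms(1) by (simp add: measure_measure_pmf_finite)
  qed
  have split: "sum f S = sum f (S \<inter> B) + sum f (S - B)" for f :: "'a \<Rightarrow> real"
    using assms(1) by (rule sum.Int_Diff)
  have "sum D S = 0"
    unfolding D_def sum_subtractf using assms by (simp add: sum_pmf_eq_1)
  then have "2 * sum D (S \<inter> B) = sum D (S \<inter> B) - sum D (S - B)"
    using split[of D] by simp
  also have "\<dots> \<le> (\<Sum>i\<in>S \<inter> B. \<bar>D i\<bar>) + (\<Sum>i\<in>S - B. \<bar>D i\<bar>)"
    using sum_abs[of D "S \<inter> B"] sum_abs[of D "S - B"] by linarith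
  also have "\<dots> = 2 * tv_dist S \<theta>1 \<theta>2"
    unfolding tv_dist_def D_def split[symmetric] by (simp add: abs_minus_commute)
  finally show ?thesis
    using prob assms by (simp add: D_def sum_subtractf)
qed

lemma chebyshev_pmf:
  fixes F :: "'a \<Rightarrow> real"
  assumes "finite (set_pmf p)" "a > 0"
    and second_moment: "measure_pmf.expectation p (\<lambda>x. (F x)\<^sup>2) - m\<^sup>2 \<le> v"
    and mean: "measure_pmf.expectation p F = m"
  shows "measure_pmf.prob p {x. a \<le> \<bar>F x - m\<bar>} \<le> v / a\<^sup>2"
proof -
  have int: "integrable (measure_pmf p) g" for g :: "'a \<Rightarrow> real"
    using assms(1) by (rule integrable_measure_pmf_finite)
  have "measure_pmf.prob p {x. a \<le> \<bar>F x - m\<bar>} \<le> measure_pmf.variance p F / a\<^sup>2"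
    using measure_pmf.Chebyshev_inequality[of F p a] assms(2) mean int by simp
  also have "measure_pmf.variance p F \<le> v"
    using measure_pmf.variance_eq[of p F] int mean second_moment by simp
  finally show ?thesis
    using assms(2) by (simp add: divide_right_mono)
qed

text \<open>
  A statistic that is concentrated near \<open>m1\<close> under one law and near \<open>m2\<close> under the other separates
  the two laws: Chebyshev's inequality is applied to the ball of radius \<open>\<Delta> / 2\<close> around \<open>m2\<close>,
  which lies at distance at least \<open>\<Delta> / 4\<close> from \<open>m1\<close>.
\<close>

lemma tv_dist_ge_of_moments:
  fixes F :: "'a \<Rightarrow> real"
  assumes "finite S" "set_pmf \<theta>1 \<subseteq> S" "set_pmf \<theta>2 \<subseteq> S" "\<Delta> > 0"
    and "measure_pmf.expectation \<theta>1 (\<lambda>x. (F x)\<^sup>2) - m1\<^sup>2 \<le> v1"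
    and "measure_pmf.expectation \<theta>1 F = m1"
    and "measure_pmf.expectation \<theta>2 (\<lambda>x. (F x)\<^sup>2) - m2\<^sup>2 \<le> v2"
    and "measure_pmf.expectation \<theta>2 F = m2"
    and far: "\<bar>m1\<bar> \<le> \<Delta> / 4" "\<bar>m2\<bar> = \<Delta>"
  shows "tv_dist S \<theta>1 \<theta>2 \<ge> 1 - 4 * v2 / \<Delta>\<^sup>2 - 16 * v1 / \<Delta>\<^sup>2"
proof -
  have fin: "finite (set_pmf \<theta>1)" "finite (set_pmf \<theta>2)"
    using assms finite_subset by blast+
  define B where "B = {x. \<bar>F x - m2\<bar> < \<Delta> / 2}"
  have "1 - measure_pmf.prob \<theta>2 B = measure_pmf.prob \<theta>2 (- B)"
    using measure_pmf.prob_compl[of B \<theta>2] by (simp add: Compl_eq_Diff_UNIV)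
  also have "- B = {x. \<Delta> / 2 \<le> \<bar>F x - m2\<bar>}"
    by (auto simp: B_def)
  also have "measure_pmf.prob \<theta>2 {x. \<Delta> / 2 \<le> \<bar>F x - m2\<bar>} \<le> v2 / (\<Delta> / 2)\<^sup>2"
    using assms by (intro chebyshev_pmf fin) auto
  also have "\<dots> = 4 * v2 / \<Delta>\<^sup>2"
    by (simp add: power_divide)
  finally have 2: "1 - measure_pmf.prob \<theta>2 B \<le> 4 * v2 / \<Delta>\<^sup>2" .
  have "measure_pmf.prob \<theta>1 B \<le> measure_pmf.prob \<theta>1 {x. \<Delta> / 4 \<le> \<bar>F x - m1\<bar>}"
  proof (rule measure_pmf.finite_measure_mono)
    show "B \<subseteq> {x. \<Delta> / 4 \<le> \<bar>F x - m1\<bar>}"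
    proof
      fix x assume "x \<in> B"
      then have "\<bar>F x - m2\<bar> < \<Delta> / 2" by (simp add: B_def)
      then have "\<Delta> / 4 \<le> \<bar>F x - m1\<bar>" using far by linarith
      then show "x \<in> {x. \<Delta> / 4 \<le> \<bar>F x - m1\<bar>}" by simp
    qed
  qed simp
  also have "\<dots> \<le> v1 / (\<Delta> / 4)\<^sup>2"
    using assms by (intro chebyshev_pmf fin) auto
  also have "\<dots> = 16 * v1 / \<Delta>\<^sup>2"
    by (simp add: power_divide)
  finally show ?thesis
    using 2 prob_diff_le_tv_dist[OF assms(1-3), of B] by linarith
qed

section \<open>The one-step operator\<close>

text \<open>
  All colorings are admitted as states here, proper or not. On the proper colorings alone, two
  colorings that differ in one vertex can be sent to colorings that differ by exchanging the colors of
  two adjacent vertices, and recoloring these two one after the other passes through an improper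
  coloring.
\<close>

locale coloring_graph =
  fixes V :: "'v set" and E :: "'v set set" and q :: nat
  assumes finite_V: "finite V" and V_nonempty: "V \<noteq> {}" and q_pos: "q > 0"
    and edge_in_V: "\<And>u v. {u, v} \<in> E \<Longrightarrow> v \<in> V"
    and no_loop: "\<And>v. {v} \<notin> E"
begin

definition states :: "('v \<Rightarrow> nat) set" where
  "states = {\<sigma>. \<forall>v\<in>V. \<sigma> v < q}"

text \<open>
  A step of the Glauber dynamics is determined by a uniformly distributed pair of a vertex and a
  proposed color.
\<close>

definition moves :: "('v \<times> nat) set" where
  "moves = V \<times> {0..<q}"

definition recolor :: "'v \<times> nat \<Rightarrow> ('v \<Rightarrow> nat) \<Rightarrow> 'v \<Rightarrow> nat" where
  "recolor m \<sigma> = (if \<forall>u. {u, fst m} \<in> E \<longrightarrow> \<sigma> u \<noteq> snd m then \<sigma>(fst m := snd m) else \<sigma>)"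

definition avg :: "('v \<times> nat \<Rightarrow> real) \<Rightarrow> real" where
  "avg g = sum g moves / (real (card V) * real q)"

definition step :: "(('v \<Rightarrow> nat) \<Rightarrow> real) \<Rightarrow> ('v \<Rightarrow> nat) \<Rightarrow> real" where
  "step f \<sigma> = avg (\<lambda>m. f (recolor m \<sigma>))"

definition nbrs :: "'v \<Rightarrow> 'v set" where
  "nbrs v = {w. {w, v} \<in> E}"

lemma card_V_pos: "card V > 0"
  using finite_V V_nonempty by (simp add: card_gt_0_iff)

lemma avg_const [simp]: "avg (\<lambda>_. k) = k"
  using card_V_pos q_pos by (simp add: avg_def moves_def card_cartesian_product)

lemma avg_add: "avg (\<lambda>m. f m + g m) = avg f + avg g"
  by (simp add: avg_def sum.distrib add_divide_distrib)

lemma avg_diff: "avg (\<lambda>m. f m - g m) = avg f - avg g"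
  by (simp add: avg_def sum_subtractf diff_divide_distrib)

lemma avg_cmult: "avg (\<lambda>m. k * f m) = k * avg f"
  by (simp add: avg_def sum_distrib_left)

lemma avg_mono: "(\<And>m. m \<in> moves \<Longrightarrow> f m \<le> g m) \<Longrightarrow> avg f \<le> avg g"
  by (simp add: avg_def divide_right_mono sum_mono)

lemma abs_avg_le: "\<bar>avg f\<bar> \<le> avg (\<lambda>m. \<bar>f m\<bar>)"
  by (simp add: avg_def divide_right_mono abs_mult)

lemma avg_vertex: "avg (\<lambda>m. f (fst m)) = sum f V / real (card V)"
proof -
  have "(\<Sum>m\<in>moves. f (fst m)) = (\<Sum>v\<in>V. \<Sum>c\<in>{0..<q}. f v)"
    by (simp add: moves_def sum.cartesian_product case_prod_unfold del: sum_constant)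
  then show ?thesis
    using q_pos by (simp add: avg_def sum_distrib_left[symmetric])
qed

lemma recolor_in_states: "\<sigma> \<in> states \<Longrightarrow> m \<in> moves \<Longrightarrow> recolor m \<sigma> \<in> states"
  by (auto simp: states_def recolor_def moves_def)

lemma expectation_glauber:
  "measure_pmf.expectation (glauber V E q \<sigma>) f = step f \<sigma>"
proof -
  have "measure_pmf.expectation (glauber V E q \<sigma>) f
      = (\<Sum>v\<in>V. (\<Sum>c\<in>{0..<q}. f (recolor (v, c) \<sigma>)) / real q) / real (card V)"
    unfolding glauber_def metropolis_def recolor_def fst_conv snd_conv
    using finite_V V_nonempty q_pos
    by (simp add: pmf_expectation_bind_pmf_of_set set_pmf_of_set sum_divide_distrib
        sum_distrib_left field_simps)
  also have "\<dots> = step f \<sigma>"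
    by (simp add: step_def avg_def moves_def sum.cartesian_product sum_divide_distrib[symmetric]
        case_prod_unfold field_simps)
  finally show ?thesis .
qed

lemma finite_set_glauber: "finite (set_pmf (glauber V E q \<sigma>))"
  using finite_V V_nonempty q_pos by (simp add: glauber_def metropolis_def set_pmf_of_set)

lemma finite_set_kernel_pow: "finite (set_pmf (kernel_pow (glauber V E q) t \<sigma>))"
  by (induction t) (simp_all add: finite_set_glauber)

lemma expectation_kernel_pow:
  "measure_pmf.expectation (kernel_pow (glauber V E q) t \<sigma>) f = (step ^^ t) f \<sigma>"
proof (induction t arbitrary: f)
  case (Suc t)
  let ?p = "kernel_pow (glauber V E q) t \<sigma>"
  have "measure_pmf.expectation (kernel_pow (glauber V E q) (Suc t) \<sigma>) f
      = (\<Sum>a\<in>set_pmf ?p. pmf ?p a *\<^sub>R measure_pmf.expectation (glauber V E q a) f)"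
    using finite_set_kernel_pow finite_set_glauber
    by (simp add: pmf_expectation_bind[where A = "set_pmf ?p"])
  also have "\<dots> = measure_pmf.expectation ?p (step f)"
    by (subst integral_measure_pmf[OF finite_set_kernel_pow])
       (auto simp: expectation_glauber mult_ac set_pmf_iff)
  also have "\<dots> = (step ^^ Suc t) f \<sigma>"
    by (simp add: Suc.IH funpow_swap1)
  finally show ?case .
qed simp

lemma step_nearby:
  assumes "\<And>\<sigma>. \<sigma> \<in> states \<Longrightarrow> \<bar>f \<sigma> - g \<sigma>\<bar> \<le> B" "\<sigma> \<in> states"
  shows "\<bar>step f \<sigma> - step g \<sigma>\<bar> \<le> B"
proof -
  have "\<bar>step f \<sigma> - step g \<sigma>\<bar> \<le> avg (\<lambda>m. \<bar>f (recolor m \<sigma>) - g (recolor m \<sigma>)\<bar>)"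
    unfolding step_def avg_diff[symmetric] by (rule abs_avg_le)
  also have "\<dots> \<le> avg (\<lambda>_. B)"
    using assms recolor_in_states by (intro avg_mono) auto
  finally show ?thesis by simp
qed

subsection \<open>Oscillations\<close>

text \<open>
  A function with \<open>osc_bound f \<delta>\<close> depends on the color of \<open>v\<close> by at most \<open>\<delta> v\<close>. The operator
  \<open>spread\<close> says how this dependence moves through the graph in one step of the dynamics.
\<close>

definition osc_bound :: "(('v \<Rightarrow> nat) \<Rightarrow> real) \<Rightarrow> ('v \<Rightarrow> real) \<Rightarrow> bool" where
  "osc_bound f \<delta> \<longleftrightarrow> (\<forall>\<sigma>\<in>states. \<forall>v\<in>V. \<forall>c<q. \<bar>f (\<sigma>(v := c)) - f \<sigma>\<bar> \<le> \<delta> v)"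

definition spread :: "('v \<Rightarrow> real) \<Rightarrow> 'v \<Rightarrow> real" where
  "spread \<delta> v = (1 - (real q - real (card (nbrs v))) / (real (card V) * real q)) * \<delta> v
      + sum \<delta> (nbrs v) / (real (card V) * real q)"

lemma osc_boundD:
  "osc_bound f \<delta> \<Longrightarrow> \<sigma> \<in> states \<Longrightarrow> v \<in> V \<Longrightarrow> c < q \<Longrightarrow> \<bar>f (\<sigma>(v := c)) - f \<sigma>\<bar> \<le> \<delta> v"
  by (simp add: osc_bound_def)

lemma osc_bound_mono: "osc_bound f \<delta> \<Longrightarrow> (\<And>v. v \<in> V \<Longrightarrow> \<delta> v \<le> \<delta>' v) \<Longrightarrow> osc_bound f \<delta>'"
  by (fastforce simp: osc_bound_def)

lemma osc_bound_min: "osc_bound f \<delta> \<Longrightarrow> osc_bound f \<delta>' \<Longrightarrow> osc_bound f (\<lambda>v. min (\<delta> v) (\<delta>' v))"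
  by (simp add: osc_bound_def)

lemma osc_bound_nonneg: "osc_bound f \<delta> \<Longrightarrow> v \<in> V \<Longrightarrow> \<delta> v \<ge> 0"
proof -
  assume "osc_bound f \<delta>" "v \<in> V"
  then have "\<bar>f ((\<lambda>_. 0)(v := 0)) - f (\<lambda>_. 0)\<bar> \<le> \<delta> v"
    using q_pos by (intro osc_boundD) (auto simp: states_def)
  then show ?thesis by linarith
qed

lemma nbrs_subset: "nbrs v \<subseteq> V"
proof
  fix w assume "w \<in> nbrs v"
  then have "{v, w} \<in> E" by (simp add: nbrs_def insert_commute)
  then show "w \<in> V" by (rule edge_in_V)
qed

lemma finite_nbrs: "finite (nbrs v)"
  using nbrs_subset finite_V by (rule finite_subset)

text \<open>
  Run the dynamics from two colorings that differ only in \<open>v\<close>, where they have the colors \<open>a\<close> and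
  \<open>b\<close>. If \<open>v\<close> is chosen, every color that no neighbor uses makes the two copies equal. If a neighbor
  \<open>w\<close> is chosen, propose \<open>c\<close> in one copy and \<open>c\<close> with \<open>a\<close> and \<open>b\<close> exchanged in the other: the color
  that is already at \<open>v\<close> is refused in both copies, all colors other than \<open>a\<close> and \<open>b\<close> meet the same
  obstacles, and only one proposal of the \<open>q\<close> can make the copies differ in \<open>w\<close>. With independent
  proposals, or with equal ones, the influence would pass at a larger rate and the final constant
  would be lost.
\<close>

lemma osc_bound_step:
  assumes osc: "osc_bound f \<delta>"
  shows "osc_bound (step f) (spread \<delta>)"
  unfolding osc_bound_def
proof (intro ballI allI impI)
  fix \<sigma> v b assume \<sigma>: "\<sigma> \<in> states" and v: "v \<in> V" and b: "b < q"
  define a where "a = \<sigma> v"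
  define \<tau> where "\<tau> = \<sigma>(v := b)"
  have a: "a < q" using \<sigma> v by (simp add: states_def a_def)
  have \<tau>: "\<tau> \<in> states" using \<sigma> b by (simp add: \<tau>_def states_def)
  define total where
    "total w = (\<Sum>c<q. f (recolor (w, c) \<tau>)) - (\<Sum>c<q. f (recolor (w, c) \<sigma>))" for w
  have \<delta>v: "\<delta> v \<ge> 0" using osc v by (rule osc_bound_nonneg)
  have self: "\<bar>total v\<bar> \<le> real (card (nbrs v)) * \<delta> v"
  proof -
    have nv: "u \<noteq> v" if "{u, v} \<in> E" for u
      using that no_loop by auto
    have "\<bar>total v\<bar> \<le> (\<Sum>c<q. \<bar>f (recolor (v, c) \<tau>) - f (recolor (v, c) \<sigma>)\<bar>)"
      unfolding total_def sum_subtractf[symmetric] by (rule sum_abs)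
    also have "\<dots> \<le> (\<Sum>c<q. if c \<in> \<sigma> ` nbrs v then \<delta> v else 0)"
    proof (rule sum_mono)
      fix c
      show "\<bar>f (recolor (v, c) \<tau>) - f (recolor (v, c) \<sigma>)\<bar> \<le> (if c \<in> \<sigma> ` nbrs v then \<delta> v else 0)"
      proof (cases "c \<in> \<sigma> ` nbrs v")
        case True
        then have "recolor (v, c) \<tau> = \<tau>" "recolor (v, c) \<sigma> = \<sigma>"
          using nv by (auto simp: recolor_def \<tau>_def nbrs_def)
        then show ?thesis
          using True osc_boundD[OF osc \<sigma> v b] by (simp add: \<tau>_def)
      next
        case False
        then have "recolor (v, c) \<tau> = \<tau>(v := c)" "recolor (v, c) \<sigma> = \<sigma>(v := c)"
          using nv by (auto simp: recolor_def \<tau>_def nbrs_def)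
        then show ?thesis using False by (simp add: \<tau>_def)
      qed
    qed
    also have "\<dots> = real (card ({..<q} \<inter> \<sigma> ` nbrs v)) * \<delta> v"
      by (simp add: sum.If_cases)
    also have "\<dots> \<le> real (card (nbrs v)) * \<delta> v"
    proof (rule mult_right_mono[OF _ \<delta>v])
      have "card ({..<q} \<inter> \<sigma> ` nbrs v) \<le> card (\<sigma> ` nbrs v)"
        using finite_nbrs by (intro card_mono) auto
      also have "\<dots> \<le> card (nbrs v)" using finite_nbrs by (rule card_image_le)
      finally show "real (card ({..<q} \<inter> \<sigma> ` nbrs v)) \<le> real (card (nbrs v))" by simp
    qed
    finally show ?thesis .
  qed
  have far: "\<bar>total w\<bar> \<le> real q * \<delta> v" if "w \<in> V" "w \<noteq> v" "w \<notin> nbrs v" for w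
  proof -
    have "\<bar>total w\<bar> \<le> (\<Sum>c<q. \<bar>f (recolor (w, c) \<tau>) - f (recolor (w, c) \<sigma>)\<bar>)"
      unfolding total_def sum_subtractf[symmetric] by (rule sum_abs)
    also have "\<dots> \<le> (\<Sum>c<q. \<delta> v)"
    proof (rule sum_mono)
      fix c assume "c \<in> {..<q}"
      then have c: "(w, c) \<in> moves" using that by (simp add: moves_def)
      have "{v, w} \<notin> E" using that by (simp add: nbrs_def insert_commute)
      then have acc: "(\<forall>u. {u, w} \<in> E \<longrightarrow> \<tau> u \<noteq> c) \<longleftrightarrow> (\<forall>u. {u, w} \<in> E \<longrightarrow> \<sigma> u \<noteq> c)"
        by (auto simp: \<tau>_def)
      have "recolor (w, c) \<tau> = (recolor (w, c) \<sigma>)(v := b)"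
        using that(2) unfolding recolor_def fst_conv snd_conv acc
        by (auto simp: \<tau>_def fun_upd_twist)
      then show "\<bar>f (recolor (w, c) \<tau>) - f (recolor (w, c) \<sigma>)\<bar> \<le> \<delta> v"
        using osc_boundD[OF osc recolor_in_states[OF \<sigma> c] v b] by simp
    qed
    finally show ?thesis by simp
  qed
  have near: "\<bar>total w\<bar> \<le> real q * \<delta> v + \<delta> w" if "w \<in> nbrs v" for w
  proof -
    have w: "w \<in> V" "w \<noteq> v" "{w, v} \<in> E" "{v, w} \<in> E"
      using that nbrs_subset no_loop by (auto simp: nbrs_def insert_commute)
    define swap where "swap = Transposition.transpose a b"
    have "bij_betw swap {..<q} {..<q}"
      using a b by (simp add: swap_def bij_betw_transpose_iff)
    then have "total w = (\<Sum>c<q. f (recolor (w, swap c) \<tau>)) - (\<Sum>c<q. f (recolor (w, c) \<sigma>))"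
      unfolding total_def by (simp add: sum.reindex_bij_betw[where g = "\<lambda>c. f (recolor (w, c) \<tau>)"])
    also have "\<bar>\<dots>\<bar> \<le> (\<Sum>c<q. \<bar>f (recolor (w, swap c) \<tau>) - f (recolor (w, c) \<sigma>)\<bar>)"
      unfolding sum_subtractf[symmetric] by (rule sum_abs)
    also have "\<dots> \<le> (\<Sum>c<q. \<delta> v + (if c = b then \<delta> w else 0))"
    proof (rule sum_mono)
      fix c assume c: "c \<in> {..<q}"
      then have \<sigma>': "recolor (w, c) \<sigma> \<in> states"
        using \<sigma> w by (intro recolor_in_states) (auto simp: moves_def)
      have sc: "swap c < q" using a b c by (auto simp: swap_def Transposition.transpose_def)
      then have \<tau>': "recolor (w, swap c) \<tau> \<in> states"
        using \<tau> w by (intro recolor_in_states) (auto simp: moves_def)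
      show "\<bar>f (recolor (w, swap c) \<tau>) - f (recolor (w, c) \<sigma>)\<bar> \<le> \<delta> v + (if c = b then \<delta> w else 0)"
      proof (cases "c = b")
        case True
        define c' where "c' = recolor (w, swap c) \<tau> w"
        have c': "c' < q" using \<tau>' w by (simp add: states_def c'_def)
        \<comment> \<open>Even if only one copy accepts, the results differ at most in \<open>v\<close> and \<open>w\<close>: change \<open>w\<close> first,
          then \<open>v\<close>.\<close>
        have eq: "recolor (w, swap c) \<tau> = ((recolor (w, c) \<sigma>)(w := c'))(v := b)"
          using w by (auto simp: recolor_def \<tau>_def c'_def fun_eq_iff)
        have "\<bar>f ((recolor (w, c) \<sigma>)(w := c')) - f (recolor (w, c) \<sigma>)\<bar> \<le> \<delta> w"
          using osc \<sigma>' w(1) c' by (rule osc_boundD)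
        moreover have "\<bar>f (((recolor (w, c) \<sigma>)(w := c'))(v := b)) - f ((recolor (w, c) \<sigma>)(w := c'))\<bar> \<le> \<delta> v"
          using \<sigma>' c' by (intro osc_boundD[OF osc _ v b]) (auto simp: states_def)
        ultimately show ?thesis using True eq by simp
      next
        case False
        have "recolor (w, swap c) \<tau> = (recolor (w, c) \<sigma>)(v := b)"
        proof (cases "c = a")
          case True
          then have "recolor (w, c) \<sigma> = \<sigma>" "recolor (w, swap c) \<tau> = \<tau>"
            using w by (auto simp: recolor_def a_def \<tau>_def swap_def)
          then show ?thesis by (simp add: \<tau>_def)
        next
          case ca: False
          then have [simp]: "swap c = c" using False by (simp add: swap_def)
          have acc: "(\<forall>u. {u, w} \<in> E \<longrightarrow> \<tau> u \<noteq> c) \<longleftrightarrow> (\<forall>u. {u, w} \<in> E \<longrightarrow> \<sigma> u \<noteq> c)"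
            using ca False by (auto simp: \<tau>_def a_def)
          show ?thesis
            using w(2) unfolding recolor_def fst_conv snd_conv \<open>swap c = c\<close> acc
            by (auto simp: \<tau>_def fun_upd_twist)
        qed
        then show ?thesis
          using osc_boundD[OF osc \<sigma>' v b] False by simp
      qed
    qed
    also have "\<dots> = real q * \<delta> v + \<delta> w"
      using b by (simp add: sum.distrib)
    finally show ?thesis .
  qed
  have split: "sum g V = g v + sum g (nbrs v) + sum g (V - insert v (nbrs v))" for g :: "'v \<Rightarrow> real"
  proof -
    have "v \<notin> nbrs v" using no_loop by (simp add: nbrs_def)
    then have "sum g (insert v (nbrs v)) = g v + sum g (nbrs v)"
      using finite_nbrs by simp
    then show ?thesis
      using sum.subset_diff[of "insert v (nbrs v)" V g] finite_V v nbrs_subset[of v] by simp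
  qed
  have "\<bar>sum total V\<bar> \<le> (\<Sum>w\<in>V. \<bar>total w\<bar>)" by (rule sum_abs)
  also have "\<dots> \<le> real (card (nbrs v)) * \<delta> v + (\<Sum>w\<in>nbrs v. real q * \<delta> v + \<delta> w)
      + (\<Sum>w\<in>V - insert v (nbrs v). real q * \<delta> v)"
    unfolding split[of "\<lambda>w. \<bar>total w\<bar>"]
    by (intro add_mono sum_mono self near far) auto
  also have "\<dots> = real (card (nbrs v)) * \<delta> v + sum \<delta> (nbrs v)
      + ((\<Sum>w\<in>V. real q * \<delta> v) - real q * \<delta> v)"
    unfolding split[of "\<lambda>w. real q * \<delta> v"] by (simp add: sum.distrib)
  also have "\<dots> = spread \<delta> v * (real (card V) * real q)"
    using card_V_pos q_pos by (simp add: spread_def field_simps)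
  finally have "\<bar>sum total V\<bar> / (real (card V) * real q) \<le> spread \<delta> v"
    using card_V_pos q_pos by (simp add: pos_divide_le_eq)
  moreover have "step f \<tau> - step f \<sigma> = sum total V / (real (card V) * real q)"
    by (simp add: step_def avg_def moves_def total_def sum_subtractf diff_divide_distrib
        sum.cartesian_product case_prod_unfold atLeast0LessThan)
  ultimately show "\<bar>step f (\<sigma>(v := b)) - step f \<sigma>\<bar> \<le> spread \<delta> v"
    using card_V_pos q_pos by (simp add: \<tau>_def abs_mult)
qed

text \<open>
  Iterating \<open>spread\<close> exactly is not necessary: a function \<open>\<delta>\<close> that \<open>spread\<close> multiplies by at most \<open>\<rho>\<close>
  controls all powers of the dynamics.
\<close>

lemma osc_bound_funpow_step:
  assumes "osc_bound f \<delta>" "\<rho> \<ge> 0" "\<And>v. v \<in> V \<Longrightarrow> spread \<delta> v \<le> \<rho> * \<delta> v"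
  shows "osc_bound ((step ^^ s) f) (\<lambda>v. \<rho> ^ s * \<delta> v)"
proof (induction s)
  case 0
  then show ?case using assms by simp
next
  case (Suc s)
  have "spread (\<lambda>v. \<rho> ^ s * \<delta> v) v = \<rho> ^ s * spread \<delta> v" for v
    unfolding spread_def sum_distrib_left[symmetric] by (simp add: algebra_simps)
  then have "spread (\<lambda>v. \<rho> ^ s * \<delta> v) v \<le> \<rho> ^ Suc s * \<delta> v" if "v \<in> V" for v
    using mult_left_mono[OF assms(3)[OF that], of "\<rho> ^ s"] assms(2) by (simp add: mult_ac)
  then show ?case
    using osc_bound_mono[OF osc_bound_step[OF Suc]] by simp
qed

subsection \<open>Covariances\<close>

lemma move_le:
  assumes "osc_bound f \<delta>" "\<sigma> \<in> states" "m \<in> moves"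
  shows "\<bar>f (recolor m \<sigma>) - f \<sigma>\<bar> \<le> \<delta> (fst m)"
  using osc_boundD[OF assms(1,2)] osc_bound_nonneg[OF assms(1)] assms(3)
  by (auto simp: recolor_def moves_def)

lemma step_cov_eq:
  "step (\<lambda>\<sigma>. f \<sigma> * g \<sigma>) \<sigma> - step f \<sigma> * step g \<sigma>
    = avg (\<lambda>m. (f (recolor m \<sigma>) - f \<sigma>) * (g (recolor m \<sigma>) - g \<sigma>))
      - avg (\<lambda>m. f (recolor m \<sigma>) - f \<sigma>) * avg (\<lambda>m. g (recolor m \<sigma>) - g \<sigma>)"
proof -
  have "(\<lambda>m. (f (recolor m \<sigma>) - f \<sigma>) * (g (recolor m \<sigma>) - g \<sigma>))
      = (\<lambda>m. f (recolor m \<sigma>) * g (recolor m \<sigma>) - f \<sigma> * g (recolor m \<sigma>)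
            - g \<sigma> * f (recolor m \<sigma>) + f \<sigma> * g \<sigma>)"
    by (auto simp: algebra_simps)
  then show ?thesis
    by (simp add: step_def avg_add avg_diff avg_cmult algebra_simps)
qed

lemma abs_avg_increment_le:
  assumes "osc_bound f \<delta>" "\<sigma> \<in> states"
  shows "\<bar>avg (\<lambda>m. f (recolor m \<sigma>) - f \<sigma>)\<bar> \<le> sum \<delta> V / real (card V)"
proof -
  have "\<bar>avg (\<lambda>m. f (recolor m \<sigma>) - f \<sigma>)\<bar> \<le> avg (\<lambda>m. \<delta> (fst m))"
    using abs_avg_le by (rule order_trans) (intro avg_mono move_le assms)
  then show ?thesis by (simp add: avg_vertex)
qed

text \<open>
  The covariance of two observables created by one step: the chosen vertex must influence both
  of them, which gives the sum over \<open>v\<close>; the product of the two mean increments is of lower order.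
\<close>

lemma step_cov_le:
  assumes f: "osc_bound f \<delta>" and g: "osc_bound g \<eta>" and \<sigma>: "\<sigma> \<in> states"
  shows "\<bar>step (\<lambda>\<sigma>. f \<sigma> * g \<sigma>) \<sigma> - step f \<sigma> * step g \<sigma>\<bar>
    \<le> (\<Sum>v\<in>V. \<delta> v * \<eta> v) / real (card V) + (sum \<delta> V / real (card V)) * (sum \<eta> V / real (card V))"
proof -
  have "\<bar>avg (\<lambda>m. (f (recolor m \<sigma>) - f \<sigma>) * (g (recolor m \<sigma>) - g \<sigma>))\<bar>
      \<le> avg (\<lambda>m. \<delta> (fst m) * \<eta> (fst m))"
    using abs_avg_le
  proof (rule order_trans, intro avg_mono)
    fix m assume m: "m \<in> moves"
    then have "\<delta> (fst m) \<ge> 0" using f by (auto simp: moves_def intro: osc_bound_nonneg)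
    then show "\<bar>(f (recolor m \<sigma>) - f \<sigma>) * (g (recolor m \<sigma>) - g \<sigma>)\<bar> \<le> \<delta> (fst m) * \<eta> (fst m)"
      unfolding abs_mult by (intro mult_mono move_le f g \<sigma> m) auto
  qed
  moreover have "\<bar>avg (\<lambda>m. f (recolor m \<sigma>) - f \<sigma>) * avg (\<lambda>m. g (recolor m \<sigma>) - g \<sigma>)\<bar>
      \<le> (sum \<delta> V / real (card V)) * (sum \<eta> V / real (card V))"
    unfolding abs_mult using f \<sigma>
    by (intro mult_mono abs_avg_increment_le f g \<sigma> divide_nonneg_nonneg sum_nonneg)
       (auto intro: osc_bound_nonneg)
  ultimately show ?thesis
    using avg_vertex[of "\<lambda>v. \<delta> v * \<eta> v"] unfolding step_cov_eq by linarith
qed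

lemma step_var_le:
  assumes f: "osc_bound f (\<lambda>_. D)" and \<sigma>: "\<sigma> \<in> states"
  shows "\<bar>step (\<lambda>\<sigma>. f \<sigma> * f \<sigma>) \<sigma> - step f \<sigma> * step f \<sigma>\<bar> \<le> D\<^sup>2"
proof -
  define A where "A = avg (\<lambda>m. (f (recolor m \<sigma>) - f \<sigma>) * (f (recolor m \<sigma>) - f \<sigma>))"
  define B where "B = avg (\<lambda>m. f (recolor m \<sigma>) - f \<sigma>)"
  have sq: "x * x \<le> D\<^sup>2" if "\<bar>x\<bar> \<le> D" for x :: real
    using power_mono[OF that, of 2] by (simp add: power2_eq_square)
  have "A \<ge> avg (\<lambda>_. 0)" unfolding A_def by (rule avg_mono) simp
  moreover have "A \<le> avg (\<lambda>_. D\<^sup>2)"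
    unfolding A_def using move_le[OF f \<sigma>] sq by (intro avg_mono) auto
  moreover have "B * B \<le> D\<^sup>2"
    unfolding B_def using abs_avg_increment_le[OF f \<sigma>] card_V_pos by (intro sq) simp
  moreover have "B * B \<ge> 0" by simp
  ultimately show ?thesis
    unfolding step_cov_eq A_def[symmetric] B_def[symmetric] avg_const by linarith
qed

text \<open>
  The chain starts from a fixed coloring, so all covariance at time \<open>t\<close> is produced by the
  \<open>t\<close> steps, and later steps only average the covariance that is already there.
\<close>

lemma funpow_step_cov_le:
  assumes one_step: "\<And>s \<sigma>. s < t \<Longrightarrow> \<sigma> \<in> states \<Longrightarrow>
      \<bar>step (\<lambda>\<sigma>. (step ^^ s) f \<sigma> * (step ^^ s) g \<sigma>) \<sigma>
        - step ((step ^^ s) f) \<sigma> * step ((step ^^ s) g) \<sigma>\<bar> \<le> B"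
    and "\<sigma> \<in> states"
  shows "\<bar>(step ^^ t) (\<lambda>\<sigma>. f \<sigma> * g \<sigma>) \<sigma> - (step ^^ t) f \<sigma> * (step ^^ t) g \<sigma>\<bar> \<le> real t * B"
  using assms
proof (induction t arbitrary: \<sigma>)
  case (Suc t)
  let ?fg = "\<lambda>\<sigma>. f \<sigma> * g \<sigma>"
  have "\<bar>step ((step ^^ t) ?fg) \<sigma> - step (\<lambda>\<sigma>. (step ^^ t) f \<sigma> * (step ^^ t) g \<sigma>) \<sigma>\<bar> \<le> real t * B"
    using Suc by (intro step_nearby) auto
  moreover have "\<bar>step (\<lambda>\<sigma>. (step ^^ t) f \<sigma> * (step ^^ t) g \<sigma>) \<sigma>
        - step ((step ^^ t) f) \<sigma> * step ((step ^^ t) g) \<sigma>\<bar> \<le> B"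
    using Suc.prems by blast
  ultimately show ?case by (simp add: algebra_simps)
qed simp

subsection \<open>Color symmetry\<close>

definition permute_colors :: "(nat \<Rightarrow> nat) \<Rightarrow> ('v \<Rightarrow> nat) \<Rightarrow> 'v \<Rightarrow> nat" where
  "permute_colors p \<sigma> = (\<lambda>v. if v \<in> V then p (\<sigma> v) else \<sigma> v)"

lemma step_permute_colors:
  assumes p: "p permutes {0..<q}"
  shows "step f (permute_colors p \<sigma>) = step (\<lambda>\<sigma>. f (permute_colors p \<sigma>)) \<sigma>"
proof -
  have inj: "p a = p b \<longleftrightarrow> a = b" for a b
    using permutes_inj[OF p] by (auto dest: injD)
  have "recolor (v, p c) (permute_colors p \<sigma>) = permute_colors p (recolor (v, c) \<sigma>)"
    if "v \<in> V" for v c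
  proof -
    have "u \<in> V" if "{u, v} \<in> E" for u
      using that edge_in_V[of v u] by (simp add: insert_commute)
    then have "(\<forall>u. {u, v} \<in> E \<longrightarrow> permute_colors p \<sigma> u \<noteq> p c) \<longleftrightarrow> (\<forall>u. {u, v} \<in> E \<longrightarrow> \<sigma> u \<noteq> c)"
      by (auto simp: permute_colors_def inj)
    then show ?thesis
      using that by (auto simp: recolor_def permute_colors_def fun_eq_iff)
  qed
  moreover have "bij_betw (\<lambda>m. (fst m, p (snd m))) moves moves"
    unfolding moves_def using bij_betw_map_prod[OF bij_betw_id permutes_imp_bij[OF p], of V]
    by (simp add: map_prod_def case_prod_unfold)
  ultimately show ?thesis
    unfolding step_def avg_def
    by (subst sum.reindex_bij_betw[symmetric, where h = "\<lambda>m. (fst m, p (snd m))"])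
       (auto intro!: sum.cong arg_cong2[where f = "(/)"] simp: moves_def)
qed

lemma funpow_step_permute_colors:
  assumes "p permutes {0..<q}"
  shows "(step ^^ t) f (permute_colors p \<sigma>) = (step ^^ t) (\<lambda>\<sigma>. f (permute_colors p \<sigma>)) \<sigma>"
proof (induction t arbitrary: \<sigma>)
  case (Suc t)
  have "(step ^^ Suc t) f (permute_colors p \<sigma>) = step (\<lambda>\<sigma>. (step ^^ t) f (permute_colors p \<sigma>)) \<sigma>"
    by (simp add: step_permute_colors[OF assms])
  also have "\<dots> = (step ^^ Suc t) (\<lambda>\<sigma>. f (permute_colors p \<sigma>)) \<sigma>"
    by (simp add: Suc.IH)
  finally show ?case .
qed simp

lemma funpow_step_uminus: "(step ^^ t) (\<lambda>\<sigma>. - f \<sigma>) \<sigma> = - (step ^^ t) f \<sigma>"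
  by (induction t arbitrary: \<sigma>) (simp_all add: step_def avg_def sum_negf)

end

section \<open>Glauber dynamics on the path\<close>

lemma mem_path_edges:
  "{u, v} \<in> path_edges n \<longleftrightarrow> u \<in> {1..n} \<and> v \<in> {1..n} \<and> (v = Suc u \<or> u = Suc v)"
  by (auto simp: path_edges_def doubleton_eq_iff)

locale path_coloring =
  fixes n q :: nat
  assumes n_pos: "n \<ge> 1" and q_ge_4: "q \<ge> 4"
begin

sublocale coloring_graph "path_vertices n" "path_edges n" q
proof
  show "{v} \<notin> path_edges n" for v
    using mem_path_edges[of v v n] by simp
qed (use n_pos q_ge_4 in \<open>auto simp: path_vertices_def mem_path_edges\<close>)

lemma card_path_vertices [simp]: "card (path_vertices n) = n"
  by (simp add: path_vertices_def)

text \<open>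
  At most two proposals at \<open>v\<close> are refused and at most two neighbors can be infected. The
  neighborhood is enlarged to \<open>{v - 1, Suc v}\<close> also at the ends of the path, which is why \<open>\<delta>\<close> has to
  be nonnegative everywhere.
\<close>

lemma spread_path_le:
  assumes "v \<in> path_vertices n" and nonneg: "\<And>w. \<delta> w \<ge> 0"
  shows "spread \<delta> v
    \<le> (1 - (real q - 2) / (real n * real q)) * \<delta> v + (\<delta> (v - 1) + \<delta> (Suc v)) / (real n * real q)"
proof -
  have sub: "nbrs v \<subseteq> {v - 1, Suc v}"
    by (auto simp: nbrs_def mem_path_edges)
  have "sum \<delta> (nbrs v) \<le> sum \<delta> {v - 1, Suc v}"
    using sub nonneg by (intro sum_mono2) auto
  then have sum: "sum \<delta> (nbrs v) \<le> \<delta> (v - 1) + \<delta> (Suc v)" by simp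
  have "card (nbrs v) \<le> card {v - 1, Suc v}"
    using sub by (intro card_mono) auto
  then have "card (nbrs v) \<le> 2" by simp
  then have "(real q - 2) / (real n * real q) \<le> (real q - real (card (nbrs v))) / (real n * real q)"
    by (intro divide_right_mono) auto
  then show ?thesis
    unfolding spread_def card_path_vertices using sum nonneg n_pos q_pos
    by (intro add_mono mult_right_mono divide_right_mono) auto
qed

text \<open>
  For \<open>q \<ge> 4\<close> a disagreement is repaired with probability at least \<open>(q - 2) / (n q)\<close> and passed on
  with probability at most \<open>2 / (n q)\<close>, so Lipschitz constants do not grow.
\<close>

lemma osc_bound_const_funpow_step:
  assumes "osc_bound f (\<lambda>_. D)"
  shows "osc_bound ((step ^^ s) f) (\<lambda>_. D)"
proof -
  have D: "D \<ge> 0" using osc_bound_nonneg[OF assms] V_nonempty by auto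
  have "spread (\<lambda>_. D) v \<le> 1 * D" if "v \<in> path_vertices n" for v
  proof -
    have "spread (\<lambda>_. D) v \<le> (1 - (real q - 2) / (real n * real q)) * D + (D + D) / (real n * real q)"
      using spread_path_le[OF that, of "\<lambda>_. D"] D by simp
    also have "\<dots> = D - (real q - 4) * D / (real n * real q)"
      by (simp add: diff_divide_distrib add_divide_distrib algebra_simps)
    also have "\<dots> \<le> D" using D q_ge_4 by simp
    finally show ?thesis by simp
  qed
  from osc_bound_funpow_step[OF assms _ this] show ?thesis by simp
qed

definition rate :: "real \<Rightarrow> real" where
  "rate z = 1 + z / (real n * real q)"

text \<open>
  Exponentials in the position are multiplied by \<open>1 + (z + 1 / z - (q - 2)) / (n q)\<close> under \<open>spread\<close>,
  and \<open>1 / z \<le> q - 2\<close>.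
\<close>

lemma spread_geometric_le:
  assumes z: "z \<ge> 1" and "K \<ge> 0" and v: "v \<in> path_vertices n"
  shows "spread (\<lambda>v. K * z ^ v) v \<le> rate z * (K * z ^ v)"
    and "spread (\<lambda>v. K / z ^ v) v \<le> rate z * (K / z ^ v)"
proof -
  have bound: "(1 - (real q - 2) / (real n * real q)) * x + (x / z + x * z) / (real n * real q)
      \<le> rate z * x" if "x \<ge> 0" for x
  proof -
    have "x / z \<le> (real q - 2) * x"
    proof -
      have "x / z \<le> x / 1" using z that by (intro divide_left_mono) auto
      also have "\<dots> \<le> (real q - 2) * x" using mult_right_mono[of 1 "real q - 2" x] that q_ge_4 by simp
      finally show ?thesis .
    qed
    then have "(x / z - (real q - 2) * x) / (real n * real q) \<le> 0"
      by (intro divide_nonpos_nonneg) auto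
    moreover have "(1 - (real q - 2) / (real n * real q)) * x + (x / z + x * z) / (real n * real q)
        = rate z * x + (x / z - (real q - 2) * x) / (real n * real q)"
      by (simp add: rate_def diff_divide_distrib add_divide_distrib algebra_simps)
    ultimately show ?thesis by linarith
  qed
  obtain w where w: "v = Suc w" using v by (cases v) (auto simp: path_vertices_def)
  show "spread (\<lambda>v. K * z ^ v) v \<le> rate z * (K * z ^ v)"
    using order_trans[OF spread_path_le[OF v, of "\<lambda>v. K * z ^ v"] _] bound[of "K * z ^ v"] assms
    by (simp add: w mult_ac)
  show "spread (\<lambda>v. K / z ^ v) v \<le> rate z * (K / z ^ v)"
    using order_trans[OF spread_path_le[OF v, of "\<lambda>v. K / z ^ v"] _] bound[of "K / z ^ v"] assms
    by (simp add: w mult_ac add.commute)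
qed

definition gap :: "nat \<Rightarrow> nat \<Rightarrow> nat" where
  "gap v i = (v - i) + (i - v)"

text \<open>
  The increasing and the decreasing exponential through \<open>i\<close> both dominate the initial oscillation.
  Their minimum decays in both directions. Using them separately keeps the rate at \<open>z\<close> instead of
  the \<open>2 z\<close> that the crude bound \<open>z\<close> for each of the two neighbors would give.
\<close>

lemma osc_bound_site_funpow_step:
  assumes osc: "osc_bound f (\<lambda>v. if v = i then K else 0)" and K: "K \<ge> 0" and z: "z \<ge> 1"
  shows "osc_bound ((step ^^ s) f) (\<lambda>v. rate z ^ s * (K * (1 / z) ^ gap v i))"
proof -
  have rate: "rate z \<ge> 0" using z by (simp add: rate_def)
  have "osc_bound ((step ^^ s) f) (\<lambda>v. rate z ^ s * (K / z ^ i * z ^ v))"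
    using osc_bound_mono[OF osc, of "\<lambda>v. K / z ^ i * z ^ v"] z K rate spread_geometric_le(1)[OF z, of "K / z ^ i"]
    by (intro osc_bound_funpow_step) auto
  moreover have "osc_bound ((step ^^ s) f) (\<lambda>v. rate z ^ s * (K * z ^ i / z ^ v))"
    using osc_bound_mono[OF osc, of "\<lambda>v. K * z ^ i / z ^ v"] z K rate spread_geometric_le(2)[OF z, of "K * z ^ i"]
    by (intro osc_bound_funpow_step) auto
  ultimately have "osc_bound ((step ^^ s) f)
      (\<lambda>v. min (rate z ^ s * (K / z ^ i * z ^ v)) (rate z ^ s * (K * z ^ i / z ^ v)))"
    by (rule osc_bound_min)
  moreover have "min (rate z ^ s * (K / z ^ i * z ^ v)) (rate z ^ s * (K * z ^ i / z ^ v))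
      \<le> rate z ^ s * (K * (1 / z) ^ gap v i)" for v
  proof (cases "v \<le> i")
    case True
    then have "(1 / z) ^ gap v i = z ^ v / z ^ i"
      using z by (simp add: gap_def power_diff power_one_over)
    then show ?thesis by (intro min.coboundedI1) simp
  next
    case False
    then have "(1 / z) ^ gap v i = z ^ i / z ^ v"
      using z by (simp add: gap_def power_diff power_one_over)
    then show ?thesis by (intro min.coboundedI2) simp
  qed
  ultimately show ?thesis by (rule osc_bound_mono)
qed

lemma sum_power_inj_le:
  fixes y :: real
  assumes "0 \<le> y" "y \<le> 1 / 2" "finite A" "inj_on g A"
  shows "(\<Sum>v\<in>A. y ^ g v) \<le> 2"
proof -
  have "(\<Sum>v\<in>A. y ^ g v) = (\<Sum>k\<in>g ` A. y ^ k)"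
    using assms by (simp add: sum.reindex)
  also have "\<dots> \<le> (\<Sum>k. y ^ k)"
    using assms by (intro sum_le_suminf summable_geometric) auto
  also have "\<dots> = 1 / (1 - y)" using assms by (intro suminf_geometric) auto
  also have "\<dots> \<le> 2" using assms by (simp add: field_simps)
  finally show ?thesis .
qed

lemma sum_power_gap_le:
  fixes y :: real
  assumes "0 \<le> y" "y \<le> 1 / 2"
  shows "(\<Sum>v\<in>path_vertices n. y ^ gap v i) \<le> 4"
proof -
  let ?A = "{v \<in> path_vertices n. v < i}" and ?B = "{v \<in> path_vertices n. i \<le> v}"
  have "path_vertices n = ?A \<union> ?B" by auto
  then have "(\<Sum>v\<in>path_vertices n. y ^ gap v i) = (\<Sum>v\<in>?A \<union> ?B. y ^ gap v i)" by simp
  also have "\<dots> = (\<Sum>v\<in>?A. y ^ gap v i) + (\<Sum>v\<in>?B. y ^ gap v i)"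
    using finite_V by (intro sum.union_disjoint) auto
  also have "\<dots> \<le> 2 + 2"
    using assms finite_V by (intro add_mono sum_power_inj_le) (auto simp: inj_on_def gap_def)
  finally show ?thesis by simp
qed

text \<open>
  Every vertex between \<open>i\<close> and \<open>i + d\<close> contributes exactly \<open>y ^ d\<close>, and the contributions decay
  geometrically outside this interval.
\<close>

lemma sum_power_two_gaps_le:
  fixes y :: real
  assumes y: "0 \<le> y" "y \<le> 1 / 2"
  shows "(\<Sum>v\<in>path_vertices n. y ^ gap v i * y ^ gap v (i + d)) \<le> (real d + 9) * y ^ d"
proof -
  have pt: "y ^ gap v i * y ^ gap v (i + d)
      \<le> y ^ d * (of_bool (v \<in> {i..i + d}) + y ^ gap v i + y ^ gap v (i + d))" for v
  proof -
    have y1: "y \<le> 1" using y by simp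
    consider "v < i" | "v \<in> {i..i + d}" | "v > i + d" by fastforce
    then show ?thesis
    proof cases
      case 1
      then have "gap v (i + d) = d + gap v i" by (simp add: gap_def)
      then have "y ^ gap v i * y ^ gap v (i + d) = y ^ d * (y ^ gap v i * y ^ gap v i)"
        by (simp add: power_add)
      also have "\<dots> \<le> y ^ d * y ^ gap v i"
        using y y1 by (intro mult_left_mono mult_left_le power_le_one) auto
      finally show ?thesis using y by (simp add: distrib_left add_increasing2 add_increasing)
    next
      case 2
      then have "d = gap v i + gap v (i + d)" by (auto simp: gap_def)
      then have "y ^ gap v i * y ^ gap v (i + d) = y ^ d"
        by (metis power_add)
      then show ?thesis using 2 y by (simp add: distrib_left)
    next
      case 3
      then have "gap v i = d + gap v (i + d)" by (simp add: gap_def)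
      then have "y ^ gap v i * y ^ gap v (i + d) = y ^ d * (y ^ gap v (i + d) * y ^ gap v (i + d))"
        by (simp add: power_add)
      also have "\<dots> \<le> y ^ d * y ^ gap v (i + d)"
        using y y1 by (intro mult_left_mono mult_left_le power_le_one) auto
      finally show ?thesis using y by (simp add: distrib_left add_increasing2 add_increasing)
    qed
  qed
  have "(\<Sum>v\<in>path_vertices n. of_bool (v \<in> {i..i + d})) = real (card (path_vertices n \<inter> {i..i + d}))"
    using finite_V by (simp add: Int_def)
  also have "\<dots> \<le> real (card {i..i + d})" by (intro of_nat_mono card_mono) auto
  finally have card: "(\<Sum>v\<in>path_vertices n. of_bool (v \<in> {i..i + d})) \<le> real d + 1" by simp
  have "(\<Sum>v\<in>path_vertices n. y ^ gap v i * y ^ gap v (i + d))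
      \<le> (\<Sum>v\<in>path_vertices n. y ^ d * (of_bool (v \<in> {i..i + d}) + y ^ gap v i + y ^ gap v (i + d)))"
    by (rule sum_mono) (rule pt)
  also have "\<dots> = y ^ d * ((\<Sum>v\<in>path_vertices n. of_bool (v \<in> {i..i + d}))
      + (\<Sum>v\<in>path_vertices n. y ^ gap v i) + (\<Sum>v\<in>path_vertices n. y ^ gap v (i + d)))"
    by (simp only: sum_distrib_left[symmetric] sum.distrib)
  also have "\<dots> \<le> y ^ d * ((real d + 1) + 4 + 4)"
    using y by (intro mult_left_mono add_mono card sum_power_gap_le) auto
  finally show ?thesis by (simp add: algebra_simps)
qed

text \<open>
  Two sites at distance \<open>d\<close> become correlated only if influence from a common vertex reaches both,
  and the two distances to that vertex add up to at least \<open>d\<close>. Both oscillation profiles carry the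
  factor \<open>rate z ^ s\<close>, whence the exponent \<open>2 * t\<close>.
\<close>

lemma two_site_covariance_le:
  fixes h :: "nat \<Rightarrow> real"
  assumes h: "\<And>a b. \<bar>h a - h b\<bar> \<le> 2" and \<sigma>: "\<sigma> \<in> states" and z: "z \<ge> 2"
  shows "\<bar>(step ^^ t) (\<lambda>\<sigma>. h (\<sigma> i) * h (\<sigma> (i + d))) \<sigma>
      - (step ^^ t) (\<lambda>\<sigma>. h (\<sigma> i)) \<sigma> * (step ^^ t) (\<lambda>\<sigma>. h (\<sigma> (i + d))) \<sigma>\<bar>
    \<le> real t * (4 * rate z ^ (2 * t) * ((real d + 9) * (1 / z) ^ d / real n + 16 / (real n)\<^sup>2))"
proof (rule funpow_step_cov_le[OF _ \<sigma>])
  fix s \<sigma> assume s: "s < t" and \<sigma>: "\<sigma> \<in> states"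
  define y where "y = 1 / z"
  have y: "0 \<le> y" "y \<le> 1 / 2" using z by (auto simp: y_def field_simps)
  define \<delta> where "\<delta> i v = rate z ^ s * (2 * y ^ gap v i)" for i v
  have osc: "osc_bound ((step ^^ s) (\<lambda>\<sigma>. h (\<sigma> i))) (\<delta> i)" for i
    unfolding \<delta>_def y_def using h z
    by (intro osc_bound_site_funpow_step) (auto simp: osc_bound_def)
  have "rate z \<ge> 1" using z by (simp add: rate_def)
  then have rate: "rate z ^ (2 * s) \<le> rate z ^ (2 * t)" "rate z \<ge> 0"
    using s by (auto intro: power_increasing)
  have double: "rate z ^ (2 * s) = rate z ^ s * rate z ^ s"
    by (simp add: mult_2 power_add)
  have sum1: "(\<Sum>v\<in>path_vertices n. \<delta> i v * \<delta> (i + d) v)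
      \<le> 4 * rate z ^ (2 * s) * ((real d + 9) * y ^ d)"
  proof -
    have "(\<Sum>v\<in>path_vertices n. \<delta> i v * \<delta> (i + d) v)
        = 4 * rate z ^ (2 * s) * (\<Sum>v\<in>path_vertices n. y ^ gap v i * y ^ gap v (i + d))"
      unfolding sum_distrib_left double by (intro sum.cong refl) (simp add: \<delta>_def)
    also have "\<dots> \<le> 4 * rate z ^ (2 * s) * ((real d + 9) * y ^ d)"
      using rate y by (intro mult_left_mono sum_power_two_gaps_le) auto
    finally show ?thesis .
  qed
  have sum2: "0 \<le> sum (\<delta> i) (path_vertices n)" "sum (\<delta> i) (path_vertices n) \<le> rate z ^ s * 8" for i
  proof -
    show "0 \<le> sum (\<delta> i) (path_vertices n)"
      using rate y by (intro sum_nonneg) (auto simp: \<delta>_def)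
    have "sum (\<delta> i) (path_vertices n) = rate z ^ s * (2 * (\<Sum>v\<in>path_vertices n. y ^ gap v i))"
      by (simp add: \<delta>_def sum_distrib_left)
    also have "\<dots> \<le> rate z ^ s * (2 * 4)"
      using rate y by (intro mult_left_mono sum_power_gap_le) auto
    finally show "sum (\<delta> i) (path_vertices n) \<le> rate z ^ s * 8" by simp
  qed
  have "sum (\<delta> i) (path_vertices n) * sum (\<delta> (i + d)) (path_vertices n)
      \<le> (rate z ^ s * 8) * (rate z ^ s * 8)"
    using sum2 rate by (intro mult_mono) auto
  also have "\<dots> = 4 * rate z ^ (2 * s) * 16"
    by (simp add: double)
  finally have sum3: "sum (\<delta> i) (path_vertices n) * sum (\<delta> (i + d)) (path_vertices n)
      \<le> 4 * rate z ^ (2 * s) * 16" .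
  have "\<bar>step (\<lambda>\<sigma>. (step ^^ s) (\<lambda>\<sigma>. h (\<sigma> i)) \<sigma> * (step ^^ s) (\<lambda>\<sigma>. h (\<sigma> (i + d))) \<sigma>) \<sigma>
        - step ((step ^^ s) (\<lambda>\<sigma>. h (\<sigma> i))) \<sigma> * step ((step ^^ s) (\<lambda>\<sigma>. h (\<sigma> (i + d)))) \<sigma>\<bar>
      \<le> (\<Sum>v\<in>path_vertices n. \<delta> i v * \<delta> (i + d) v) / real n
        + sum (\<delta> i) (path_vertices n) * sum (\<delta> (i + d)) (path_vertices n) / (real n)\<^sup>2"
    using step_cov_le[OF osc osc \<sigma>, of i "i + d"] by (simp add: power2_eq_square)
  also have "\<dots> \<le> 4 * rate z ^ (2 * s) * ((real d + 9) * y ^ d) / real n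
        + 4 * rate z ^ (2 * s) * 16 / (real n)\<^sup>2"
    by (intro add_mono divide_right_mono sum1 sum3) auto
  also have "\<dots> = 4 * rate z ^ (2 * s) * ((real d + 9) * y ^ d / real n + 16 / (real n)\<^sup>2)"
    by (simp add: distrib_left mult_ac)
  also have "\<dots> \<le> 4 * rate z ^ (2 * t) * ((real d + 9) * y ^ d / real n + 16 / (real n)\<^sup>2)"
    using rate y by (intro mult_right_mono mult_left_mono add_nonneg_nonneg) auto
  finally show "\<bar>step (\<lambda>\<sigma>. (step ^^ s) (\<lambda>\<sigma>. h (\<sigma> i)) \<sigma> * (step ^^ s) (\<lambda>\<sigma>. h (\<sigma> (i + d))) \<sigma>) \<sigma>
        - step ((step ^^ s) (\<lambda>\<sigma>. h (\<sigma> i))) \<sigma> * step ((step ^^ s) (\<lambda>\<sigma>. h (\<sigma> (i + d)))) \<sigma>\<bar>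
      \<le> 4 * rate z ^ (2 * t) * ((real d + 9) * (1 / z) ^ d / real n + 16 / (real n)\<^sup>2)"
    by (simp add: y_def)
qed

end

section \<open>The statistic\<close>

text \<open>
  The two colors with nonzero charge do not occur in the initial coloring, and exchanging them
  changes the sign of the charge.
\<close>

definition charge :: "nat \<Rightarrow> real" where
  "charge c = of_bool (c = 2) - of_bool (c = 3)"

text \<open>
  The pairs have length \<open>d\<close> and are separated by stretches of length \<open>2 * d\<close>, so that in equilibrium
  different pairs are less correlated than the square of the signal.
\<close>

definition pair_pos :: "nat \<Rightarrow> nat \<Rightarrow> nat" where
  "pair_pos d k = 3 * d * k + 1"

definition pair_stat :: "nat \<Rightarrow> nat \<Rightarrow> (nat \<Rightarrow> nat) \<Rightarrow> real" where
  "pair_stat d k \<sigma> = charge (\<sigma> (pair_pos d k)) * charge (\<sigma> (pair_pos d k + d))"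

definition total_stat :: "nat \<Rightarrow> nat \<Rightarrow> (nat \<Rightarrow> nat) \<Rightarrow> real" where
  "total_stat d N \<sigma> = (\<Sum>k<N. pair_stat d k \<sigma>)"

lemma charge_bounds: "\<bar>charge c\<bar> \<le> 1" "\<bar>charge a - charge b\<bar> \<le> 2"
  by (auto simp: charge_def)

lemma pair_pos_le:
  assumes "d \<ge> 1" "3 * d * N \<le> n" "k < N"
  shows "pair_pos d k + d \<le> n"
proof -
  have "3 * d * k + 3 * d \<le> n"
    using mult_le_mono2[of "Suc k" N "3 * d"] assms by simp
  then show ?thesis using assms(1) by (simp add: pair_pos_def)
qed

context path_coloring
begin

definition alternating :: "nat \<Rightarrow> nat" where
  "alternating = (\<lambda>i\<in>path_vertices n. i mod 2)"

lemma alternating_proper: "alternating \<in> proper_colorings (path_vertices n) (path_edges n) q"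
  using q_ge_4
  by (auto simp: alternating_def proper_colorings_def colorings_def path_vertices_def path_edges_def
      doubleton_eq_iff mod2_eq_if)

lemma proper_in_states: "proper_colorings (path_vertices n) (path_edges n) q \<subseteq> states"
  by (auto simp: proper_colorings_def colorings_def states_def PiE_iff)

text \<open>
  The initial coloring uses only the colors 0 and 1, so the law of the chain is invariant under
  exchanging 2 and 3.
\<close>

lemma funpow_step_charge_alternating:
  assumes i: "i \<in> path_vertices n"
  shows "(step ^^ t) (\<lambda>\<sigma>. charge (\<sigma> i)) alternating = 0"
proof -
  define p where "p = Transposition.transpose 2 (3 :: nat)"
  have p: "p permutes {0..<q}"
    unfolding p_def using q_ge_4 by (intro permutes_swap_id) auto
  have "permute_colors p alternating = alternating"
    by (auto simp: permute_colors_def alternating_def p_def Transposition.transpose_def mod2_eq_if)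
  then have "(step ^^ t) (\<lambda>\<sigma>. charge (\<sigma> i)) alternating
      = (step ^^ t) (\<lambda>\<sigma>. charge (permute_colors p \<sigma> i)) alternating"
    using funpow_step_permute_colors[OF p, of t "\<lambda>\<sigma>. charge (\<sigma> i)" alternating] by simp
  also have "(\<lambda>\<sigma>. charge (permute_colors p \<sigma> i)) = (\<lambda>\<sigma>. - charge (\<sigma> i))"
    using i by (auto simp: permute_colors_def p_def Transposition.transpose_def charge_def)
  finally show ?thesis
    by (simp add: funpow_step_uminus)
qed

text \<open>
  A vertex is the left end of at most one pair and the right end of at most one pair.
\<close>

lemma osc_bound_total_stat:
  assumes d: "d \<ge> 1"
  shows "osc_bound (total_stat d N) (\<lambda>_. 4)"
  unfolding osc_bound_def
proof (intro ballI allI impI)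
  fix \<sigma> v c
  have one: "(\<Sum>k<N. of_bool (v = pair_pos d k + e) :: real) \<le> 1" for e
  proof -
    have "(\<Sum>k<N. of_bool (v = pair_pos d k + e) :: real) = real (card {k \<in> {..<N}. v = pair_pos d k + e})"
      by (simp add: Int_def)
    moreover have "card {k \<in> {..<N}. v = pair_pos d k + e} \<le> Suc 0"
      using d by (subst card_le_Suc0_iff_eq) (auto simp: pair_pos_def)
    ultimately show ?thesis by simp
  qed
  have pt: "\<bar>pair_stat d k (\<sigma>(v := c)) - pair_stat d k \<sigma>\<bar>
      \<le> 2 * of_bool (v = pair_pos d k + 0) + 2 * of_bool (v = pair_pos d k + d)" for k
  proof -
    have prod: "\<bar>x\<bar> * \<bar>y\<bar> \<le> 2" if "\<bar>x\<bar> \<le> 2" "\<bar>y\<bar> \<le> 1" for x y :: real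
      using mult_mono[OF that] by simp
    have "\<bar>charge a * charge b - charge a' * charge b\<bar> \<le> 2"
      "\<bar>charge b * charge a - charge b * charge a'\<bar> \<le> 2" for a a' b
      unfolding left_diff_distrib[symmetric] right_diff_distrib[symmetric] abs_mult
      using prod charge_bounds by (auto simp: mult.commute[of "\<bar>charge b\<bar>"])
    then show ?thesis using d by (simp add: pair_stat_def)
  qed
  have "\<bar>total_stat d N (\<sigma>(v := c)) - total_stat d N \<sigma>\<bar>
      \<le> (\<Sum>k<N. \<bar>pair_stat d k (\<sigma>(v := c)) - pair_stat d k \<sigma>\<bar>)"
    unfolding total_stat_def sum_subtractf[symmetric] by (rule sum_abs)
  also have "\<dots> \<le> (\<Sum>k<N. 2 * of_bool (v = pair_pos d k + 0) + 2 * of_bool (v = pair_pos d k + d))"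
    by (rule sum_mono) (rule pt)
  also have "\<dots> = 2 * (\<Sum>k<N. of_bool (v = pair_pos d k + 0)) + 2 * (\<Sum>k<N. of_bool (v = pair_pos d k + d))"
    by (simp only: sum.distrib sum_distrib_left)
  also have "\<dots> \<le> 4" using one[of 0] one[of d] by linarith
  finally show "\<bar>total_stat d N (\<sigma>(v := c)) - total_stat d N \<sigma>\<bar> \<le> 4" .
qed

lemma alternating_total_stat_variance:
  assumes "d \<ge> 1"
  shows "(step ^^ t) (\<lambda>\<sigma>. (total_stat d N \<sigma>)\<^sup>2) alternating
      - ((step ^^ t) (total_stat d N) alternating)\<^sup>2 \<le> 16 * real t"
proof -
  have "\<bar>(step ^^ t) (\<lambda>\<sigma>. total_stat d N \<sigma> * total_stat d N \<sigma>) alternating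
      - (step ^^ t) (total_stat d N) alternating * (step ^^ t) (total_stat d N) alternating\<bar>
      \<le> real t * 4\<^sup>2"
    using alternating_proper proper_in_states
    by (intro funpow_step_cov_le step_var_le osc_bound_const_funpow_step osc_bound_total_stat assms) auto
  then show ?thesis by (simp add: power2_eq_square)
qed

lemma funpow_step_sum:
  "(step ^^ t) (\<lambda>\<sigma>. \<Sum>k\<in>A. f k \<sigma>) \<sigma> = (\<Sum>k\<in>A. (step ^^ t) (f k) \<sigma>)"
proof (induction t arbitrary: \<sigma>)
  case (Suc t)
  have "(step ^^ t) (\<lambda>\<sigma>. \<Sum>k\<in>A. f k \<sigma>) = (\<lambda>\<sigma>. \<Sum>k\<in>A. (step ^^ t) (f k) \<sigma>)"
    by (rule ext) (rule Suc.IH)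
  then have "(step ^^ Suc t) (\<lambda>\<sigma>. \<Sum>k\<in>A. f k \<sigma>) \<sigma> = step (\<lambda>\<sigma>. \<Sum>k\<in>A. (step ^^ t) (f k) \<sigma>) \<sigma>"
    by simp
  also have "\<dots> = (\<Sum>k\<in>A. step ((step ^^ t) (f k)) \<sigma>)"
    unfolding step_def avg_def sum_divide_distrib by (rule sum.swap)
  finally show ?case by simp
qed simp

text \<open>
  Since each charge has mean zero at all times, the mean of a pair is the covariance of its ends.
\<close>

lemma alternating_total_stat_mean:
  assumes d: "d \<ge> 1" and N: "3 * d * N \<le> n" and z: "z \<ge> 2"
  shows "\<bar>(step ^^ t) (total_stat d N) alternating\<bar> \<le> real N * (real t *
      (4 * rate z ^ (2 * t) * ((real d + 9) * (1 / z) ^ d / real n + 16 / (real n)\<^sup>2)))"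
    (is "_ \<le> real N * ?B")
proof -
  have "\<bar>(step ^^ t) (pair_stat d k) alternating\<bar> \<le> ?B" if "k < N" for k
  proof -
    have "pair_pos d k \<in> path_vertices n"
      using pair_pos_le[OF d N that] by (simp add: path_vertices_def pair_pos_def)
    moreover have "pair_stat d k
        = (\<lambda>\<sigma>. charge (\<sigma> (pair_pos d k)) * charge (\<sigma> (pair_pos d k + d)))"
      by (rule ext) (rule pair_stat_def)
    moreover have "alternating \<in> states"
      using alternating_proper proper_in_states by blast
    ultimately show ?thesis
      using two_site_covariance_le[of charge alternating z t "pair_pos d k" d]
        charge_bounds(2) z funpow_step_charge_alternating
      by simp
  qed
  then have "\<bar>\<Sum>k<N. (step ^^ t) (pair_stat d k) alternating\<bar> \<le> (\<Sum>k<N. ?B)"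
    by (intro order_trans[OF sum_abs] sum_mono) auto
  moreover have "(step ^^ t) (total_stat d N) alternating = (\<Sum>k<N. (step ^^ t) (pair_stat d k) alternating)"
    unfolding total_stat_def[abs_def] by (rule funpow_step_sum)
  ultimately show ?thesis
    by simp
qed

end

section \<open>Uniform colorings of the path as a Markov chain in space\<close>

text \<open>
  Read from left to right, a uniformly random proper coloring is a Markov chain that moves to one of
  the \<open>q - 1\<close> other colors with equal probability. A function of the color with sum zero is an
  eigenfunction of its transition matrix, with eigenvalue \<open>- 1 / (q - 1)\<close>.
\<close>

definition path_colorings :: "nat \<Rightarrow> nat \<Rightarrow> (nat \<Rightarrow> nat) set" where
  "path_colorings q n = proper_colorings (path_vertices n) (path_edges n) q"

definition unif :: "nat \<Rightarrow> nat \<Rightarrow> ((nat \<Rightarrow> nat) \<Rightarrow> real) \<Rightarrow> real" where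
  "unif q n f = sum f (path_colorings q n) / real (card (path_colorings q n))"

definition determined_upto :: "nat \<Rightarrow> ((nat \<Rightarrow> nat) \<Rightarrow> real) \<Rightarrow> bool" where
  "determined_upto m f \<longleftrightarrow> (\<forall>\<sigma> \<tau>. (\<forall>v\<in>{1..m}. \<sigma> v = \<tau> v) \<longrightarrow> f \<sigma> = f \<tau>)"

lemma path_colorings_iff:
  "\<sigma> \<in> path_colorings q n \<longleftrightarrow>
    (\<forall>v. (v \<in> {1..n} \<longrightarrow> \<sigma> v < q) \<and> (v \<notin> {1..n} \<longrightarrow> \<sigma> v = undefined))
    \<and> (\<forall>i\<ge>1. i < n \<longrightarrow> \<sigma> i \<noteq> \<sigma> (Suc i))"
  unfolding path_colorings_def proper_colorings_def colorings_def path_vertices_def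
  by (auto simp: mem_path_edges PiE_iff extensional_def Suc_le_eq) metis

lemma finite_path_colorings: "finite (path_colorings q n)"
  by (simp add: path_colorings_def path_vertices_def finite_proper_colorings)

lemma card_path_colorings_pos: "q \<ge> 2 \<Longrightarrow> card (path_colorings q n) > 0"
  using finite_path_colorings[of q n] proper_colorings_path_nonempty[of q n]
  by (simp add: path_colorings_def card_gt_0_iff)

lemma determined_upto_upd: "determined_upto n f \<Longrightarrow> f (\<sigma>(Suc n := c)) = f \<sigma>"
  by (auto simp: determined_upto_def)

lemma determined_upto_mono: "determined_upto m f \<Longrightarrow> m \<le> n \<Longrightarrow> determined_upto n f"
  unfolding determined_upto_def by auto

lemma determined_upto_mult_site:
  assumes "determined_upto m f" "m \<le> j" "1 \<le> j"
  shows "determined_upto j (\<lambda>\<sigma>. f \<sigma> * \<phi> (\<sigma> j))"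
  unfolding determined_upto_def
proof (intro allI impI)
  fix \<sigma> \<tau> :: "nat \<Rightarrow> nat" assume eq: "\<forall>v\<in>{1..j}. \<sigma> v = \<tau> v"
  then have "f \<sigma> = f \<tau>"
    using determined_upto_mono[OF assms(1,2)] unfolding determined_upto_def by blast
  moreover have "\<sigma> j = \<tau> j" using eq assms(3) by simp
  ultimately show "f \<sigma> * \<phi> (\<sigma> j) = f \<tau> * \<phi> (\<tau> j)" by simp
qed

text \<open>
  A proper coloring of the longer path is a proper coloring of the shorter one together with any
  color different from the last.
\<close>

lemma sum_path_colorings_Suc:
  assumes n: "n \<ge> 1" and f: "determined_upto n f"
  shows "(\<Sum>\<sigma>\<in>path_colorings q (Suc n). f \<sigma> * \<phi> (\<sigma> (Suc n)))
    = (\<Sum>\<sigma>\<in>path_colorings q n. f \<sigma> * ((\<Sum>c<q. \<phi> c) - \<phi> (\<sigma> n)))"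
proof -
  have "(\<Sum>\<sigma>\<in>path_colorings q (Suc n). f \<sigma> * \<phi> (\<sigma> (Suc n)))
      = (\<Sum>(\<sigma>, c)\<in>(SIGMA \<sigma>:path_colorings q n. {..<q} - {\<sigma> n}). f \<sigma> * \<phi> c)"
  proof (rule sum.reindex_bij_witness[where
        i = "\<lambda>(\<sigma>, c). \<sigma>(Suc n := c)" and j = "\<lambda>\<tau>. (\<tau>(Suc n := undefined), \<tau> (Suc n))"])
    fix \<tau> assume \<tau>: "\<tau> \<in> path_colorings q (Suc n)"
    then have "\<tau>(Suc n := undefined) \<in> path_colorings q n" "\<tau> (Suc n) < q" "\<tau> n \<noteq> \<tau> (Suc n)"
      using n by (auto simp: path_colorings_iff)
    then show "(\<tau>(Suc n := undefined), \<tau> (Suc n)) \<in> (SIGMA \<sigma>:path_colorings q n. {..<q} - {\<sigma> n})"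
      by auto
    show "(case (\<tau>(Suc n := undefined), \<tau> (Suc n)) of (\<sigma>, c) \<Rightarrow> f \<sigma> * \<phi> c) = f \<tau> * \<phi> (\<tau> (Suc n))"
      by (simp add: determined_upto_upd[OF f])
  next
    fix p assume p: "p \<in> (SIGMA \<sigma>:path_colorings q n. {..<q} - {\<sigma> n})"
    then obtain \<sigma> c where [simp]: "p = (\<sigma>, c)" and \<sigma>: "\<sigma> \<in> path_colorings q n" "c < q" "c \<noteq> \<sigma> n"
      by auto
    have "\<sigma> (Suc n) = undefined" using \<sigma>(1) by (simp add: path_colorings_iff)
    then show "((case p of (\<sigma>, c) \<Rightarrow> \<sigma>(Suc n := c))(Suc n := undefined),
        (case p of (\<sigma>, c) \<Rightarrow> \<sigma>(Suc n := c)) (Suc n)) = p"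
      by (auto simp: fun_upd_idem)
    show "(case p of (\<sigma>, c) \<Rightarrow> \<sigma>(Suc n := c)) \<in> path_colorings q (Suc n)"
      using \<sigma> n by (auto simp: path_colorings_iff less_Suc_eq)
  qed auto
  also have "\<dots> = (\<Sum>\<sigma>\<in>path_colorings q n. \<Sum>c\<in>{..<q} - {\<sigma> n}. f \<sigma> * \<phi> c)"
    by (subst sum.Sigma) (simp_all add: finite_path_colorings)
  also have "\<dots> = (\<Sum>\<sigma>\<in>path_colorings q n. f \<sigma> * ((\<Sum>c<q. \<phi> c) - \<phi> (\<sigma> n)))"
  proof (rule sum.cong[OF refl])
    fix \<sigma> assume "\<sigma> \<in> path_colorings q n"
    then have "\<sigma> n < q" using n by (simp add: path_colorings_iff)
    then show "(\<Sum>c\<in>{..<q} - {\<sigma> n}. f \<sigma> * \<phi> c) = f \<sigma> * ((\<Sum>c<q. \<phi> c) - \<phi> (\<sigma> n))"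
      by (simp add: sum_distrib_left[symmetric] sum_diff1)
  qed
  finally show ?thesis .
qed

lemma sum_const_path_colorings_Suc:
  assumes "n \<ge> 1" "determined_upto n f"
  shows "sum f (path_colorings q (Suc n)) = (real q - 1) * sum f (path_colorings q n)"
  using sum_path_colorings_Suc[OF assms, where q = q and \<phi> = "\<lambda>_. 1"] by (simp add: sum_distrib_left mult.commute)

lemma card_path_colorings_Suc:
  assumes "n \<ge> 1"
  shows "real (card (path_colorings q (Suc n))) = (real q - 1) * real (card (path_colorings q n))"
  using sum_const_path_colorings_Suc[OF assms, of "\<lambda>_. 1"] by (simp add: determined_upto_def)

lemma unif_extend:
  assumes "m \<ge> 1" "m \<le> n" "q \<ge> 2" and f: "determined_upto m f"
  shows "unif q n f = unif q m f"
  using assms(2)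
proof (induction n rule: dec_induct)
  case (step n)
  have "determined_upto n f" using f step(1) by (rule determined_upto_mono)
  then show ?case
    using step assms sum_const_path_colorings_Suc[of n f q] card_path_colorings_Suc[of n q]
    by (simp add: unif_def)
qed simp

lemma unif_cmult: "unif q n (\<lambda>\<sigma>. k * f \<sigma>) = k * unif q n f"
  by (simp add: unif_def sum_distrib_left)

lemma unif_add: "unif q n (\<lambda>\<sigma>. f \<sigma> + g \<sigma>) = unif q n f + unif q n g"
  by (simp add: unif_def sum.distrib add_divide_distrib)

lemma unif_sum: "unif q n (\<lambda>\<sigma>. \<Sum>k\<in>A. f k \<sigma>) = (\<Sum>k\<in>A. unif q n (f k))"
  unfolding unif_def sum_divide_distrib by (rule sum.swap)

lemma abs_unif_le:
  assumes "\<And>\<sigma>. \<bar>f \<sigma>\<bar> \<le> B" "q \<ge> 2"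
  shows "\<bar>unif q n f\<bar> \<le> B"
proof -
  have "\<bar>sum f (path_colorings q n)\<bar> \<le> (\<Sum>\<sigma>\<in>path_colorings q n. \<bar>f \<sigma>\<bar>)" by (rule sum_abs)
  also have "\<dots> \<le> (\<Sum>\<sigma>\<in>path_colorings q n. B)" using assms by (intro sum_mono)
  finally show ?thesis
    using card_path_colorings_pos[OF assms(2), of n] by (simp add: unif_def divide_le_eq mult.commute)
qed

text \<open>
  Conditioning on the first \<open>m\<close> colors applies \<open>j - m\<close> steps of the spatial Markov chain to \<open>\<phi>\<close>.
\<close>

lemma unif_decay:
  assumes m: "1 \<le> m" and "m \<le> j" "j \<le> n" "q \<ge> 2"
    and f: "determined_upto m f" and \<phi>: "(\<Sum>c<q. \<phi> c) = 0"
  shows "unif q n (\<lambda>\<sigma>. f \<sigma> * \<phi> (\<sigma> j)) = (- 1 / (real q - 1)) ^ (j - m) * unif q m (\<lambda>\<sigma>. f \<sigma> * \<phi> (\<sigma> m))"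
proof -
  have det: "determined_upto j (\<lambda>\<sigma>. f \<sigma> * \<phi> (\<sigma> j))"
    using f m \<open>m \<le> j\<close> by (intro determined_upto_mult_site) auto
  have "unif q n (\<lambda>\<sigma>. f \<sigma> * \<phi> (\<sigma> j)) = unif q j (\<lambda>\<sigma>. f \<sigma> * \<phi> (\<sigma> j))"
    using assms det by (intro unif_extend) auto
  also have "\<dots> = (- 1 / (real q - 1)) ^ (j - m) * unif q m (\<lambda>\<sigma>. f \<sigma> * \<phi> (\<sigma> m))"
    using \<open>m \<le> j\<close>
  proof (induction j rule: dec_induct)
    case (step j)
    have j: "j \<ge> 1" and detj: "determined_upto j f"
      using m step(1) determined_upto_mono[OF f] by auto
    have "unif q (Suc j) (\<lambda>\<sigma>. f \<sigma> * \<phi> (\<sigma> (Suc j))) = (- 1 / (real q - 1)) * unif q j (\<lambda>\<sigma>. f \<sigma> * \<phi> (\<sigma> j))"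
      unfolding unif_def sum_path_colorings_Suc[OF j detj] \<phi> card_path_colorings_Suc[OF j]
      by (simp add: sum_negf)
    then show ?case using step by (simp add: Suc_diff_le)
  qed simp
  finally show ?thesis .
qed

lemma unif_site_centered:
  assumes "1 \<le> j" "j \<le> n" "q \<ge> 2" and \<phi>: "(\<Sum>c<q. \<phi> c) = 0"
  shows "unif q n (\<lambda>\<sigma>. \<phi> (\<sigma> j)) = 0"
proof -
  have "(\<Sum>\<sigma>\<in>path_colorings q 1. \<phi> (\<sigma> 1)) = (\<Sum>c<q. \<phi> c)"
    by (rule sum.reindex_bij_witness[where i = "\<lambda>c. (\<lambda>_. undefined)(1 := c)" and j = "\<lambda>\<sigma>. \<sigma> 1"])
       (auto simp: path_colorings_iff fun_eq_iff)
  then have "unif q 1 (\<lambda>\<sigma>. 1 * \<phi> (\<sigma> 1)) = 0"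
    using \<phi> by (simp add: unif_def)
  then show ?thesis
    using unif_decay[of 1 j n q "\<lambda>_. 1" \<phi>] assms by (simp add: determined_upto_def)
qed

section \<open>Moments of the statistic in equilibrium\<close>

text \<open>
  The eigenvalue of the spatial Markov chain on functions with sum zero.
\<close>

definition decay :: "nat \<Rightarrow> real" where
  "decay q = - 1 / (real q - 1)"

lemma sum_charge: "q \<ge> 4 \<Longrightarrow> (\<Sum>c<q. charge c) = 0"
  by (simp add: charge_def sum_subtractf)

lemma sum_charge_sq: "q \<ge> 4 \<Longrightarrow> (\<Sum>c<q. (charge c)\<^sup>2 - 2 / real q) = 0"
proof -
  assume q: "q \<ge> 4"
  have "(charge c)\<^sup>2 = of_bool (c = 2) + of_bool (c = 3)" for c
    by (auto simp: charge_def)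
  then show ?thesis using q by (simp add: sum_subtractf sum.distrib)
qed

text \<open>
  The correlation between the ends of a pair is \<open>decay q ^ (j - i)\<close> times the squared charge at the
  left end. The latter is split into its mean \<open>2 / q\<close> and a function with sum zero, to which the
  decay of correlations can be applied once more.
\<close>

lemma unif_charge_pair:
  assumes f: "determined_upto i f" and ij: "1 \<le> i" "i \<le> j" "j \<le> n" and q: "q \<ge> 4"
  shows "unif q n (\<lambda>\<sigma>. f \<sigma> * (charge (\<sigma> i) * charge (\<sigma> j)))
    = decay q ^ (j - i) * (2 / real q * unif q n f + unif q n (\<lambda>\<sigma>. f \<sigma> * ((charge (\<sigma> i))\<^sup>2 - 2 / real q)))"
proof -
  have det: "determined_upto i (\<lambda>\<sigma>. f \<sigma> * charge (\<sigma> i))"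
    by (rule determined_upto_mult_site[OF f order_refl ij(1)])
  have det': "determined_upto i (\<lambda>\<sigma>. f \<sigma> * ((charge (\<sigma> i))\<^sup>2 - 2 / real q))"
    by (rule determined_upto_mult_site[OF f order_refl ij(1), of "\<lambda>c. (charge c)\<^sup>2 - 2 / real q"])
  have "unif q n (\<lambda>\<sigma>. (f \<sigma> * charge (\<sigma> i)) * charge (\<sigma> j))
      = decay q ^ (j - i) * unif q i (\<lambda>\<sigma>. (f \<sigma> * charge (\<sigma> i)) * charge (\<sigma> i))"
    unfolding decay_def using assms det by (intro unif_decay sum_charge) auto
  also have "(\<lambda>\<sigma>. (f \<sigma> * charge (\<sigma> i)) * charge (\<sigma> i))
      = (\<lambda>\<sigma>. 2 / real q * f \<sigma> + f \<sigma> * ((charge (\<sigma> i))\<^sup>2 - 2 / real q))"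
    by (simp add: fun_eq_iff power2_eq_square algebra_simps)
  also have "unif q i \<dots> = 2 / real q * unif q i f + unif q i (\<lambda>\<sigma>. f \<sigma> * ((charge (\<sigma> i))\<^sup>2 - 2 / real q))"
    by (simp only: unif_add unif_cmult)
  also have "unif q i f = unif q n f"
    using assms by (intro unif_extend[symmetric]) auto
  also have "unif q i (\<lambda>\<sigma>. f \<sigma> * ((charge (\<sigma> i))\<^sup>2 - 2 / real q))
      = unif q n (\<lambda>\<sigma>. f \<sigma> * ((charge (\<sigma> i))\<^sup>2 - 2 / real q))"
    using assms det' by (intro unif_extend[symmetric]) auto
  finally show ?thesis by (simp only: mult.assoc)
qed

lemma unif_pair_stat:
  assumes "pair_pos d k + d \<le> n" and q: "q \<ge> 4"
  shows "unif q n (pair_stat d k) = decay q ^ d * (2 / real q)"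
proof -
  have one: "unif q n (\<lambda>_. 1) = 1"
    using card_path_colorings_pos[of q n] q by (simp add: unif_def)
  have pos: "1 \<le> pair_pos d k" by (simp add: pair_pos_def)
  have "unif q n (\<lambda>\<sigma>. (charge (\<sigma> (pair_pos d k)))\<^sup>2 - 2 / real q) = 0"
    using assms pos by (intro unif_site_centered sum_charge_sq) auto
  then show ?thesis
    using unif_charge_pair[of "pair_pos d k" "\<lambda>_. 1" "pair_pos d k + d" n q] assms one pos
    by (simp add: determined_upto_def pair_stat_def[abs_def])
qed

lemma abs_pair_stat_le: "\<bar>pair_stat d k \<sigma>\<bar> \<le> 1"
  unfolding pair_stat_def abs_mult using charge_bounds(1) by (intro mult_le_one) auto

lemma abs_decay_le: "q \<ge> 4 \<Longrightarrow> \<bar>decay q\<bar> \<le> 1"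
  by (simp add: decay_def divide_le_eq)

text \<open>
  One factor \<open>\<bar>decay q\<bar> ^ d\<close> comes from the second pair, and \<open>\<bar>decay q\<bar> ^ (2 * d)\<close> from the distance
  between the two pairs.
\<close>

lemma unif_pair_stat_mult:
  assumes kl: "k < l" "pair_pos d l + d \<le> n" and q: "q \<ge> 4"
  shows "unif q n (\<lambda>\<sigma>. pair_stat d k \<sigma> * pair_stat d l \<sigma>)
    \<le> (decay q ^ d * (2 / real q))\<^sup>2 + \<bar>decay q\<bar> ^ (3 * d)"
proof -
  let ?i = "pair_pos d k + d" and ?j = "pair_pos d l"
  have mult: "3 * d * k + 3 * d \<le> 3 * d * l"
    using mult_le_mono2[of "Suc k" l "3 * d"] kl by simp
  then have ij: "1 \<le> ?i" "?i \<le> ?j" "?i + 2 * d \<le> ?j" "pair_pos d k \<le> ?i"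
    by (auto simp: pair_pos_def)
  have det: "determined_upto ?i (pair_stat d k)"
    unfolding determined_upto_def pair_stat_def by (auto simp: pair_pos_def)
  define \<phi> where "\<phi> c = (charge c)\<^sup>2 - 2 / real q" for c
  have \<phi>: "\<bar>\<phi> c\<bar> \<le> 1" for c
    using q by (auto simp: \<phi>_def charge_def field_simps)
  have "unif q n (\<lambda>\<sigma>. pair_stat d k \<sigma> * pair_stat d l \<sigma>)
      = decay q ^ d * (2 / real q * unif q n (pair_stat d k) + unif q n (\<lambda>\<sigma>. pair_stat d k \<sigma> * \<phi> (\<sigma> ?j)))"
    using unif_charge_pair[of ?j "pair_stat d k" "?j + d" n q] determined_upto_mono[OF det ij(2)] ij kl q
    by (simp add: pair_stat_def[of d l] \<phi>_def)
  also have "unif q n (pair_stat d k) = decay q ^ d * (2 / real q)"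
    using ij kl q by (intro unif_pair_stat) auto
  also have "unif q n (\<lambda>\<sigma>. pair_stat d k \<sigma> * \<phi> (\<sigma> ?j))
      = decay q ^ (?j - ?i) * unif q ?i (\<lambda>\<sigma>. pair_stat d k \<sigma> * \<phi> (\<sigma> ?i))"
    unfolding decay_def using ij kl q det sum_charge_sq[OF q] by (intro unif_decay) (auto simp: \<phi>_def)
  finally have "unif q n (\<lambda>\<sigma>. pair_stat d k \<sigma> * pair_stat d l \<sigma>)
      = (decay q ^ d * (2 / real q))\<^sup>2
        + decay q ^ (d + (?j - ?i)) * unif q ?i (\<lambda>\<sigma>. pair_stat d k \<sigma> * \<phi> (\<sigma> ?i))"
    by (simp add: power2_eq_square power_add algebra_simps)
  moreover have "decay q ^ (d + (?j - ?i)) * unif q ?i (\<lambda>\<sigma>. pair_stat d k \<sigma> * \<phi> (\<sigma> ?i))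
      \<le> \<bar>decay q\<bar> ^ (3 * d) * 1"
  proof (rule order_trans[OF abs_ge_self])
    have "\<bar>decay q\<bar> ^ (d + (?j - ?i)) \<le> \<bar>decay q\<bar> ^ (3 * d)"
      using abs_decay_le[OF q] ij by (intro power_decreasing) auto
    moreover have "\<bar>unif q ?i (\<lambda>\<sigma>. pair_stat d k \<sigma> * \<phi> (\<sigma> ?i))\<bar> \<le> 1"
      using q by (intro abs_unif_le) (auto simp: abs_mult intro!: mult_le_one abs_pair_stat_le \<phi>)
    ultimately show "\<bar>decay q ^ (d + (?j - ?i)) * unif q ?i (\<lambda>\<sigma>. pair_stat d k \<sigma> * \<phi> (\<sigma> ?i))\<bar>
        \<le> \<bar>decay q\<bar> ^ (3 * d) * 1"
      unfolding abs_mult power_abs by (intro mult_mono) auto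
  qed
  ultimately show ?thesis by simp
qed

lemma unif_total_stat_mean:
  assumes "d \<ge> 1" "3 * d * N \<le> n" "q \<ge> 4"
  shows "unif q n (total_stat d N) = real N * (decay q ^ d * (2 / real q))"
proof -
  have "unif q n (total_stat d N) = (\<Sum>k<N. unif q n (pair_stat d k))"
    unfolding total_stat_def unif_sum by simp
  also have "\<dots> = (\<Sum>k<N. decay q ^ d * (2 / real q))"
    using assms pair_pos_le by (intro sum.cong unif_pair_stat) auto
  finally show ?thesis by simp
qed

lemma unif_total_stat_variance:
  assumes "d \<ge> 1" "3 * d * N \<le> n" and q: "q \<ge> 4"
  shows "unif q n (\<lambda>\<sigma>. (total_stat d N \<sigma>)\<^sup>2) - (real N * (decay q ^ d * (2 / real q)))\<^sup>2
    \<le> real N + (real N)\<^sup>2 * \<bar>decay q\<bar> ^ (3 * d)"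
proof -
  let ?m = "decay q ^ d * (2 / real q)"
  have pt: "unif q n (\<lambda>\<sigma>. pair_stat d k \<sigma> * pair_stat d l \<sigma>)
      \<le> of_bool (k = l) + (?m\<^sup>2 + \<bar>decay q\<bar> ^ (3 * d))" if "k < N" "l < N" for k l
  proof -
    consider "k < l" | "l < k" | "k = l" by linarith
    then show ?thesis
    proof cases
      case 1
      then show ?thesis using unif_pair_stat_mult[of k l d n q] pair_pos_le[of d N n l] assms that by simp
    next
      case 2
      then show ?thesis
        using unif_pair_stat_mult[of l k d n q] pair_pos_le[of d N n k] assms that by (simp add: mult.commute)
    next
      case 3
      have "\<bar>unif q n (\<lambda>\<sigma>. pair_stat d k \<sigma> * pair_stat d l \<sigma>)\<bar> \<le> 1"
        using q by (intro abs_unif_le) (auto simp: abs_mult intro!: mult_le_one abs_pair_stat_le)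
      moreover have "0 \<le> ?m\<^sup>2 + \<bar>decay q\<bar> ^ (3 * d)" by simp
      ultimately show ?thesis using 3 by (simp only: of_bool_eq simp_thms)
    qed
  qed
  have "unif q n (\<lambda>\<sigma>. (total_stat d N \<sigma>)\<^sup>2)
      = (\<Sum>k<N. \<Sum>l<N. unif q n (\<lambda>\<sigma>. pair_stat d k \<sigma> * pair_stat d l \<sigma>))"
    by (simp only: total_stat_def power2_eq_square sum_product unif_sum)
  also have "\<dots> \<le> (\<Sum>k<N. \<Sum>l<N. of_bool (k = l) + (?m\<^sup>2 + \<bar>decay q\<bar> ^ (3 * d)))"
    by (intro sum_mono pt) auto
  also have "\<dots> = (\<Sum>k<N. 1 + real N * (?m\<^sup>2 + \<bar>decay q\<bar> ^ (3 * d)))"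
    by (intro sum.cong refl) (simp add: sum.distrib of_bool_def)
  also have "\<dots> = real N + (real N)\<^sup>2 * (?m\<^sup>2 + \<bar>decay q\<bar> ^ (3 * d))"
    by (simp add: power2_eq_square algebra_simps)
  also have "\<dots> = (real N * ?m)\<^sup>2 + (real N + (real N)\<^sup>2 * \<bar>decay q\<bar> ^ (3 * d))"
    by (simp only: power_mult_distrib[of "real N" ?m] distrib_left add_ac)
  finally show ?thesis by simp
qed

section \<open>Distance from equilibrium\<close>

context path_coloring
begin

lemma kernel_pow_alternating_subset:
  "set_pmf (kernel_pow (glauber (path_vertices n) (path_edges n) q) t alternating) \<subseteq> path_colorings q n"
proof (induction t)
  case 0
  then show ?case using alternating_proper by (simp add: path_colorings_def)
next
  case (Suc t)
  then show ?case
    using set_glauber_subset[OF q_pos finite_V V_nonempty] by (auto simp: path_colorings_def)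
qed

text \<open>
  In equilibrium the statistic has a mean of absolute value \<open>2 N r / q\<close>, whereas at time \<open>t\<close> its mean is at
  most a quarter of this. The two error terms are the variances at the two times, divided by the
  square of this difference.
\<close>

lemma tv_dist_alternating_ge:
  assumes d: "d \<ge> 1" and N: "N \<ge> 1" "3 * d * N \<le> n" and z: "z \<ge> 2"
    and r: "r = (1 / (real q - 1)) ^ d"
    and small: "real t * (4 * rate z ^ (2 * t) * ((real d + 9) * (1 / z) ^ d / real n + 16 / (real n)\<^sup>2))
      \<le> r / (2 * real q)"
  shows "tv_dist (path_colorings q n)
      (kernel_pow (glauber (path_vertices n) (path_edges n) q) t alternating)
      (pmf_of_set (path_colorings q n))
    \<ge> 1 - (real q)\<^sup>2 * (1 / (real N * r\<^sup>2) + r) - 64 * (real q)\<^sup>2 * real t / ((real N)\<^sup>2 * r\<^sup>2)"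
proof -
  let ?p = "kernel_pow (glauber (path_vertices n) (path_edges n) q) t alternating"
  let ?\<pi> = "pmf_of_set (path_colorings q n)"
  define \<Delta> where "\<Delta> = real N * (r * (2 / real q))"
  have r_pos: "r > 0" using q_ge_4 by (simp add: r)
  have abs_decay: "\<bar>decay q\<bar> ^ k = (1 / (real q - 1)) ^ k" for k
    using q_ge_4 by (simp add: decay_def)
  have r3: "\<bar>decay q\<bar> ^ (3 * d) = r ^ 3"
    by (simp add: abs_decay r power_mult[symmetric] mult.commute)
  have fin: "finite (path_colorings q n)" "path_colorings q n \<noteq> {}"
    using card_path_colorings_pos[of q n] q_ge_4 finite_path_colorings by auto
  have exp_unif: "measure_pmf.expectation ?\<pi> f = unif q n f" for f
    using fin by (simp add: integral_pmf_of_set unif_def)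
  have \<Delta>: "\<Delta> > 0" using N r_pos q_pos by (simp add: \<Delta>_def)
  have "tv_dist (path_colorings q n) ?p ?\<pi>
      \<ge> 1 - 4 * (real N + (real N)\<^sup>2 * r ^ 3) / \<Delta>\<^sup>2 - 16 * (16 * real t) / \<Delta>\<^sup>2"
  proof (rule tv_dist_ge_of_moments[OF _ _ _ \<Delta>])
    show "measure_pmf.expectation ?p (\<lambda>x. (total_stat d N x)\<^sup>2)
        - ((step ^^ t) (total_stat d N) alternating)\<^sup>2 \<le> 16 * real t"
      unfolding expectation_kernel_pow using d by (rule alternating_total_stat_variance)
    show "measure_pmf.expectation ?\<pi> (\<lambda>x. (total_stat d N x)\<^sup>2)
        - (real N * (decay q ^ d * (2 / real q)))\<^sup>2 \<le> real N + (real N)\<^sup>2 * r ^ 3"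
      unfolding exp_unif r3[symmetric] using d N(2) q_ge_4 by (rule unif_total_stat_variance)
    show "measure_pmf.expectation ?\<pi> (total_stat d N) = real N * (decay q ^ d * (2 / real q))"
      unfolding exp_unif using d N(2) q_ge_4 by (rule unif_total_stat_mean)
    show "\<bar>(step ^^ t) (total_stat d N) alternating\<bar> \<le> \<Delta> / 4"
    proof -
      have "\<bar>(step ^^ t) (total_stat d N) alternating\<bar> \<le> real N * (r / (2 * real q))"
        using alternating_total_stat_mean[OF d N(2) z, of t] mult_left_mono[OF small, of "real N"]
        by linarith
      then show ?thesis by (simp add: \<Delta>_def mult.commute)
    qed
    show "\<bar>real N * (decay q ^ d * (2 / real q))\<bar> = \<Delta>"
      by (simp add: \<Delta>_def abs_mult power_abs abs_decay r)
  qed (use fin kernel_pow_alternating_subset expectation_kernel_pow in auto)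
  moreover have "4 * (real N + (real N)\<^sup>2 * r ^ 3) / \<Delta>\<^sup>2 = (real q)\<^sup>2 * (1 / (real N * r\<^sup>2) + r)"
    using N r_pos q_pos by (simp add: \<Delta>_def field_simps power2_eq_square power3_eq_cube)
  moreover have "16 * (16 * real t) / \<Delta>\<^sup>2 = 64 * (real q)\<^sup>2 * real t / ((real N)\<^sup>2 * r\<^sup>2)"
    using N r_pos q_pos by (simp add: \<Delta>_def field_simps power2_eq_square)
  ultimately show ?thesis by simp
qed

lemma rate_power_le: "z \<ge> 0 \<Longrightarrow> rate z ^ k \<le> exp (real k * z / (real n * real q))"
proof -
  assume z: "z \<ge> 0"
  have "rate z ^ k \<le> exp (z / (real n * real q)) ^ k"
    using z exp_ge_add_one_self[of "z / (real n * real q)"] by (intro power_mono) (auto simp: rate_def)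
  then show ?thesis by (simp add: exp_of_nat_mult[symmetric])
qed

end

text \<open>
  Here the distance \<open>d\<close> is chosen. Write \<open>L = log (q - 1) n\<close>, so that the time is at most
  \<open>q n L / (6 e (q - 1))\<close>. With \<open>z = e (q - 1)\<close> the covariance of the ends of a pair is of order
  \<open>exp (L / 3 - d) (q - 1) ^ (- d)\<close> up to powers of \<open>L\<close>, which is small against the equilibrium correlation
  \<open>(q - 1) ^ (- d)\<close> as soon as \<open>d\<close> exceeds \<open>L / 3\<close> by a fixed factor. The total signal
  \<open>n (q - 1) ^ (- d)\<close> is large against the fluctuations, of order the square root of \<open>n\<close> up to powers
  of \<open>L\<close>, as long as \<open>d\<close> is below \<open>L / 2\<close> by a fixed factor. The value \<open>d = 2 L / 5\<close> satisfies both.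
\<close>

lemma tv_dist_alternating_eventually:
  fixes q :: nat and \<epsilon> :: real
  assumes q: "q \<ge> 4" and \<epsilon>: "\<epsilon> < 1"
  shows "\<forall>\<^sub>F n in sequentially. \<forall>t.
    real t \<le> real q * real n * (1 / 3 * log (real q - 1) (real n)) / (2 * exp 1 * (real q - 1)) \<longrightarrow>
    tv_dist (path_colorings q n)
      (kernel_pow (glauber (path_vertices n) (path_edges n) q) t (path_coloring.alternating n))
      (pmf_of_set (path_colorings q n)) > \<epsilon>"
proof -
  define m where "m = real q - 1"
  define K where "K = ln m"
  have m: "m \<ge> 3" using q by (simp add: m_def)
  \<comment> \<open>This is where \<open>q \<ge> 4\<close> enters the asymptotics: \<open>K \<ge> 1\<close> gives \<open>L \<le> ln n\<close>, so the factor
    \<open>exp (L / 3) / n\<close> of the lower-order covariance term is at most \<open>n powr (- 2 / 3)\<close>, which is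
    below the signal per pair of order \<open>n powr (- 2 / 5)\<close>.\<close>
  have "exp 1 \<le> m" using e_less_272 m by linarith
  then have K: "K \<ge> 1" using m by (simp add: K_def ln_ge_iff)
  have exp_K: "exp K = m" using m by (simp add: K_def)
  define c where "c = 1 / (15 * K)"
  have c: "c > 0" using K by (simp add: c_def)
  have "(\<lambda>n. 4 * ln (real n) * (ln (real n) + 9) * exp (- c * ln (real n))) \<longlonglongrightarrow> 0"
    using c by real_asymp
  moreover have "(\<lambda>n. 64 * ln (real n) * m * exp (- 4 / 15 * ln (real n))) \<longlonglongrightarrow> 0"
    using m by real_asymp
  ultimately have "(\<lambda>n. 4 * ln (real n) * (ln (real n) + 9) * exp (- c * ln (real n))
      + 64 * ln (real n) * m * exp (- 4 / 15 * ln (real n))) \<longlonglongrightarrow> 0 + 0"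
    by (rule tendsto_add)
  from order_tendstoD(2)[OF this, unfolded add_0, of "1 / (2 * real q)"]
  have ev1: "\<forall>\<^sub>F n in sequentially. 4 * ln (real n) * (ln (real n) + 9) * exp (- c * ln (real n))
      + 64 * ln (real n) * m * exp (- 4 / 15 * ln (real n)) < 1 / (2 * real q)"
    using q by simp
  define err where "err lg = (m + 1)\<^sup>2 * (6 * lg * (m\<^sup>2 * exp (- 1 / 5 * lg)) + exp (- 2 / 5 * lg))
      + 64 * (m + 1)\<^sup>2 * (36 * lg ^ 3 * (m\<^sup>2 * exp (- 1 / 5 * lg)))" for lg :: real
  have "(\<lambda>n. err (ln (real n))) \<longlonglongrightarrow> 0"
    unfolding err_def using m by real_asymp
  from order_tendstoD(2)[OF this, of "1 - \<epsilon>"]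
  have ev2: "\<forall>\<^sub>F n in sequentially. err (ln (real n)) < 1 - \<epsilon>"
    using \<epsilon> by simp
  have ev3: "\<forall>\<^sub>F n in sequentially. 2 * K \<le> ln (real n) \<and> 6 * ln (real n) \<le> real n"
  proof (rule eventually_conj)
    have "filterlim (\<lambda>n. ln (real n)) at_top sequentially" by real_asymp
    then show "\<forall>\<^sub>F n in sequentially. 2 * K \<le> ln (real n)"
      by (simp add: filterlim_at_top)
    show "\<forall>\<^sub>F n in sequentially. 6 * ln (real n) \<le> real n" by real_asymp
  qed
  show ?thesis
    using ev1 ev2 ev3 eventually_ge_at_top[of 2]
  proof eventually_elim
    case (elim n)
    interpret path_coloring n q
      using elim q by unfold_locales auto
    define lg where "lg = ln (real n)"
    define L where "L = lg / K"
    have lg: "2 * K \<le> lg" "6 * lg \<le> real n" "exp lg = real n"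
      using elim by (auto simp: lg_def)
    have L: "2 \<le> L" "L \<le> lg" "L * K = lg"
    proof -
      show "2 \<le> L" using lg(1) K by (simp add: L_def field_simps)
      show LK: "L * K = lg" using K by (simp add: L_def)
      have "L * 1 \<le> L * K" using K \<open>2 \<le> L\<close> by (intro mult_left_mono) auto
      then show "L \<le> lg" using LK by simp
    qed
    define d where "d = nat \<lceil>2 / 5 * L\<rceil>"
    have d: "2 / 5 * L \<le> real d" "real d \<le> 2 / 5 * L + 1"
      using L unfolding d_def by linarith+
    have "d \<ge> 1" using d L by linarith
    have d_le: "real d \<le> lg" using d L by linarith
    define r where "r = (1 / m) ^ d"
    have r_exp: "r = exp (- (K * real d))"
    proof -
      have "m ^ d = exp (K * real d)" by (simp add: exp_K[symmetric] exp_of_nat2_mult)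
      then show ?thesis by (simp add: r_def power_one_over exp_minus inverse_eq_divide)
    qed
    have Kd: "2 / 5 * lg \<le> K * real d" "K * real d \<le> K + 2 / 5 * lg"
    proof -
      have "2 / 5 * lg = K * (2 / 5 * L)" by (simp add: L(3)[symmetric])
      also have "\<dots> \<le> K * real d" using K d(1) by (intro mult_left_mono) auto
      finally show "2 / 5 * lg \<le> K * real d" .
      have "K * real d \<le> K * (2 / 5 * L + 1)" using K d(2) by (intro mult_left_mono) auto
      also have "\<dots> = K + 2 / 5 * lg" by (simp add: L(3)[symmetric] algebra_simps)
      finally show "K * real d \<le> K + 2 / 5 * lg" .
    qed
    have r_le: "r \<le> exp (- 2 / 5 * lg)"
      using Kd(1) unfolding r_exp by simp
    have r_ge: "1 / r \<le> m * exp (2 / 5 * lg)"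
    proof -
      have "1 / r = exp (K * real d)" by (simp add: r_exp exp_minus field_simps)
      also have "\<dots> \<le> exp (K + 2 / 5 * lg)"
        using Kd(2) by simp
      finally show ?thesis by (simp add: exp_add exp_K)
    qed
    have r_pos: "r > 0" by (simp add: r_exp)
    define N where "N = n div (3 * d)"
    have N_le: "3 * d * N \<le> n" by (simp add: N_def)
    have n_pos': "real n > 0" and lg_pos: "lg > 0" using elim L by auto
    have N_ge: "real n / (6 * lg) \<le> real N"
    proof -
      have "n < 3 * d * N + 3 * d"
        using dividend_less_times_div[of "3 * d" n] \<open>d \<ge> 1\<close> by (simp add: N_def)
      then have "real n < real (3 * d * N + 3 * d)" by (simp only: of_nat_less_iff)
      then have "real n \<le> 3 * real d * (real N + 1)" by (simp add: algebra_simps)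
      also have "\<dots> \<le> 3 * lg * (real N + 1)"
        using d_le by (intro mult_right_mono) auto
      finally have "real n \<le> 3 * lg * real N + 3 * lg" by (simp add: algebra_simps)
      then have "real n \<le> 6 * lg * real N" using lg(2) by linarith
      then show ?thesis using lg_pos by (simp add: field_simps)
    qed
    have N_pos: "real N > 0"
      using N_ge n_pos' lg_pos by (smt (verit) divide_pos_pos)
    then have "N \<ge> 1" by simp
    have inv_N: "1 / real N \<le> 6 * lg / real n"
      using N_ge N_pos n_pos' lg_pos by (simp add: field_simps)
    have inv_r2: "1 / r\<^sup>2 \<le> m\<^sup>2 * exp (4 / 5 * lg)"
    proof -
      have "1 / r\<^sup>2 = (1 / r)\<^sup>2" by (simp add: power_one_over)
      also have "\<dots> \<le> (m * exp (2 / 5 * lg))\<^sup>2"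
        using r_ge r_pos by (intro power_mono) auto
      also have "\<dots> = m\<^sup>2 * exp (4 / 5 * lg)"
        by (simp add: power_mult_distrib exp_double[symmetric])
      finally show ?thesis .
    qed
    have exp_over_n: "exp x / real n = exp (x - lg)" for x
      by (simp add: exp_diff lg(3))
    have noise: "1 / (real N * r\<^sup>2) \<le> 6 * lg * (m\<^sup>2 * exp (- 1 / 5 * lg))"
    proof -
      have "1 / (real N * r\<^sup>2) = (1 / real N) * (1 / r\<^sup>2)" by simp
      also have "\<dots> \<le> (6 * lg / real n) * (m\<^sup>2 * exp (4 / 5 * lg))"
        using lg_pos by (intro mult_mono inv_N inv_r2) auto
      also have "\<dots> = 6 * lg * (m\<^sup>2 * (exp (4 / 5 * lg) / real n))" by simp
      finally show ?thesis unfolding exp_over_n by simp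
    qed
    define z where "z = exp 1 * m"
    have "exp 1 \<ge> (1 :: real)" by simp
    then have "z \<ge> 1 * m" unfolding z_def using m by (intro mult_right_mono) auto
    then have z: "z \<ge> 2" using m by simp
    show ?case
    proof (intro allI impI)
      fix t assume "real t \<le> real q * real n * (1 / 3 * log (real q - 1) (real n)) / (2 * exp 1 * (real q - 1))"
      also have "\<dots> = real q * real n * L / (6 * z)"
        by (simp add: log_def L_def lg_def K_def m_def z_def mult_ac)
      finally have t: "real t \<le> real q * real n * L / (6 * z)" .
      \<comment> \<open>A cruder bound for \<open>t\<close>, for the places where only its order of magnitude matters.\<close>
      have t_le: "real t \<le> real n * lg"
      proof -
        have "real q \<le> 6 * z" using \<open>z \<ge> 1 * m\<close> m by (simp add: m_def)
        then have "real q / (6 * z) \<le> 1" using z by simp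
        then have "real q / (6 * z) * (real n * L) \<le> 1 * (real n * lg)"
          using L by (intro mult_mono) auto
        then show ?thesis using t by (simp add: mult_ac)
      qed
      \<comment> \<open>The constant \<open>1 / (2 e)\<close> of the theorem is what makes this exponent \<open>L / 3\<close>.\<close>
      have rate: "rate z ^ (2 * t) \<le> exp (L / 3)"
      proof -
        have "real (2 * t) * z / (real n * real q) \<le> L / 3"
          using t z n_pos' q_pos by (simp add: field_simps)
        then show ?thesis
          using rate_power_le[of z "2 * t"] z by (meson exp_le_cancel_iff order_trans zero_le_numeral)
      qed
      have inv_z: "(1 / z) ^ d \<le> exp (- (2 / 5 * L)) * r"
      proof -
        have "(1 / z) ^ d = (1 / exp 1) ^ d * r"
          by (simp add: z_def r_def power_mult_distrib[symmetric])
        also have "(1 / exp 1) ^ d = exp (- real d)"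
          by (simp add: exp_minus exp_of_nat_mult[of d 1, simplified] power_one_over inverse_eq_divide)
        finally show ?thesis using d(1) r_pos by (simp add: mult_right_mono)
      qed
      have "real t * (4 * rate z ^ (2 * t) * ((real d + 9) * (1 / z) ^ d / real n + 16 / (real n)\<^sup>2))
          \<le> (real n * lg) * (4 * exp (L / 3) * ((lg + 9) * (exp (- (2 / 5 * L)) * r) / real n + 16 / (real n)\<^sup>2))"
        using t_le rate inv_z d_le z lg_pos r_pos
        by (intro mult_mono add_mono divide_right_mono mult_nonneg_nonneg add_nonneg_nonneg divide_nonneg_nonneg)
          (auto simp: rate_def)
      also have "\<dots> = 4 * lg * (lg + 9) * exp (L / 3 - 2 / 5 * L) * r + 64 * lg * (exp (L / 3) / real n)"
      proof -
        have "exp (L / 3 - 2 / 5 * L) = exp (L / 3) * exp (- (2 / 5 * L))"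
          unfolding exp_add[symmetric] by simp
        then show ?thesis using n_pos' by (simp only:) (simp add: field_simps power2_eq_square)
      qed
      also have "\<dots> \<le> 4 * lg * (lg + 9) * exp (- c * lg) * r + 64 * lg * (m * exp (- 4 / 15 * lg) * r)"
      proof (intro add_mono mult_left_mono)
        have "L / 3 - 2 / 5 * L = - c * lg" by (simp add: c_def L_def field_simps)
        then show "4 * lg * (lg + 9) * exp (L / 3 - 2 / 5 * L) * r \<le> 4 * lg * (lg + 9) * exp (- c * lg) * r"
          by simp
        have "1 \<le> m * exp (2 / 5 * lg) * r" using r_ge r_pos by (simp add: field_simps)
        then have "exp (L / 3) / real n * 1 \<le> exp (lg / 3) / real n * (m * exp (2 / 5 * lg) * r)"
          using L n_pos' by (intro mult_mono divide_right_mono) auto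
        also have "\<dots> = m * (exp (lg / 3 - lg) * exp (2 / 5 * lg)) * r"
          unfolding exp_over_n by simp
        also have "exp (lg / 3 - lg) * exp (2 / 5 * lg) = exp (- 4 / 15 * lg)"
          unfolding exp_add[symmetric] by simp
        finally show "exp (L / 3) / real n \<le> m * exp (- 4 / 15 * lg) * r" by simp
      qed (use lg_pos in auto)
      also have "\<dots> = (4 * lg * (lg + 9) * exp (- c * lg) + 64 * lg * m * exp (- 4 / 15 * lg)) * r"
        by (simp add: algebra_simps)
      also have "\<dots> \<le> 1 / (2 * real q) * r"
        using elim(1) r_pos unfolding lg_def by (intro mult_right_mono) auto
      finally have small: "real t * (4 * rate z ^ (2 * t)
          * ((real d + 9) * (1 / z) ^ d / real n + 16 / (real n)\<^sup>2)) \<le> r / (2 * real q)"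
        by simp
      have drift: "real t / ((real N)\<^sup>2 * r\<^sup>2) \<le> 36 * lg ^ 3 * (m\<^sup>2 * exp (- 1 / 5 * lg))"
      proof -
        have "real t / ((real N)\<^sup>2 * r\<^sup>2) = real t * ((1 / real N) * (1 / (real N * r\<^sup>2)))"
          by (simp add: power2_eq_square)
        also have "\<dots> \<le> (real n * lg) * ((6 * lg / real n) * (6 * lg * (m\<^sup>2 * exp (- 1 / 5 * lg))))"
          using lg_pos N_pos by (intro mult_mono t_le inv_N noise) auto
        also have "\<dots> = 36 * lg ^ 3 * (m\<^sup>2 * exp (- 1 / 5 * lg))"
          using n_pos' by (simp add: power3_eq_cube)
        finally show ?thesis .
      qed
      have "\<epsilon> < 1 - err lg" using elim(2) by (simp add: lg_def)
      also have "\<dots> \<le> 1 - (real q)\<^sup>2 * (1 / (real N * r\<^sup>2) + r) - 64 * (real q)\<^sup>2 * real t / ((real N)\<^sup>2 * r\<^sup>2)"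
      proof -
        have mq: "m + 1 = real q" by (simp add: m_def)
        have "(real q)\<^sup>2 * (1 / (real N * r\<^sup>2) + r)
            \<le> (m + 1)\<^sup>2 * (6 * lg * (m\<^sup>2 * exp (- 1 / 5 * lg)) + exp (- 2 / 5 * lg))"
          unfolding mq by (intro mult_left_mono add_mono noise r_le) auto
        moreover have "64 * (real q)\<^sup>2 * (real t / ((real N)\<^sup>2 * r\<^sup>2))
            \<le> 64 * (m + 1)\<^sup>2 * (36 * lg ^ 3 * (m\<^sup>2 * exp (- 1 / 5 * lg)))"
          unfolding mq by (intro mult_left_mono drift) auto
        ultimately show ?thesis by (simp add: err_def)
      qed
      also have "\<dots> \<le> tv_dist (path_colorings q n)
         (kernel_pow (glauber (path_vertices n) (path_edges n) q) t alternating)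
         (pmf_of_set (path_colorings q n))"
        using \<open>d \<ge> 1\<close> \<open>N \<ge> 1\<close> N_le z small by (intro tv_dist_alternating_ge) (auto simp: r_def m_def)
      finally show "\<epsilon> < tv_dist (path_colorings q n)
         (kernel_pow (glauber (path_vertices n) (path_edges n) q) t alternating)
         (pmf_of_set (path_colorings q n))" .
    qed
  qed
qed

theorem theorem24:
  fixes q :: nat and \<epsilon> :: real
  assumes "q \<ge> 4" and "\<epsilon> < 1"
  shows "\<forall>\<^sub>F n in sequentially.
           ereal_of_enat (mix_glauber_path q n \<epsilon>)
             \<ge> ereal (real q * real n * (1 / 3 * log (real q - 1) (real n) - 2)
                        / (2 * exp 1 * (real q - 1)))"
  using tv_dist_alternating_eventually[OF assms] eventually_ge_at_top[of 1]
proof eventually_elim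
  case (elim n)
  interpret path_coloring n q
    using elim assms by unfold_locales auto
  let ?K = "glauber (path_vertices n) (path_edges n) q"
  define B where "B = real q * real n * (1 / 3 * log (real q - 1) (real n) - 2) / (2 * exp 1 * (real q - 1))"
  define T where "T = {t. t > 0 \<and> tv_dist (path_colorings q n) (kernel_pow ?K t alternating)
      (pmf_of_set (path_colorings q n)) \<le> \<epsilon>}"
  \<comment> \<open>The \<open>- 2\<close> in the bound only lowers it.\<close>
  have "B \<le> real q * real n * (1 / 3 * log (real q - 1) (real n)) / (2 * exp 1 * (real q - 1))"
    unfolding B_def using assms by (intro divide_right_mono mult_left_mono) auto
  then have T: "B \<le> real t" if "t \<in> T" for t
    using elim(1)[rule_format, of t] that unfolding T_def by fastforce
  have "ereal B \<le> ereal_of_enat (Inf (enat ` T))"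
  proof (cases "T = {}")
    case True
    then show ?thesis by (simp add: Inf_enat_def)
  next
    case False
    then have "Inf (enat ` T) \<in> enat ` T"
      unfolding Inf_enat_def by (auto intro: LeastI)
    then show ?thesis using T by auto
  qed
  also have "Inf (enat ` T) = mix_from (path_colorings q n) ?K (pmf_of_set (path_colorings q n)) \<epsilon> alternating"
    by (simp add: mix_from_def T_def)
  also have "ereal_of_enat \<dots> \<le> ereal_of_enat (mix_glauber_path q n \<epsilon>)"
    using alternating_proper
    by (auto simp: mix_glauber_path_def mix_def path_colorings_def Let_def intro!: SUP_upper)
  finally show ?case by (simp add: B_def)
qed

end
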